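(* Let $n\ge 5$ be an odd integer, let $D=[d_{ij}]$ be the distance matrix of the wheel graph $W_n$ with $n$ vertices, and let $\widetilde L$ be the special Laplacian matrix of $W_n$ (both defined explicitly in the context). Then: (i) $\widetilde L\,\mathbf 1_n=\mathbf 0$, where $\mathbf 1_n$ is the all-ones vector in $\mathbb{R}^n$. (ii) $\operatorname{rank}(\widetilde L)=n-2$. (iii) If $\widetilde L^{\dagger}=[\theta_{ij}]$ is the Moore–Penrose inverse of $\widetilde L$, then $d_{ij}=\theta_{ii}+\theta_{jj}-2\theta_{ij}$ for all $i,j\in\{1,\dots,n\}$. (iv) $\widetilde L$ is positive semidefinite.
   Context: Prime denotes transpose. $\mathbf 1$ is the all-ones column vector in $\mathbb{R}^{n-1}$. For a row vector $(x_1,\dots,x_r)$, $\mathrm{Circ}(x_1,\dots,x_r)$ is the $r\times r$ circulant matrix with first row $(x_1,\dots,x_r)$, each subsequent row being the cyclic right shift by one of the previous row. The wheel graph $W_n$ has a center vertex $w_1$ adjacent to all other vertices $w_2,\dots,w_n$, which form a cycle $w_2,w_3,\dots,w_n,w_2$ of length $n-1$. With this labelling its distance matrix is the $n\times n$ matrix $$D=\begin{bmatrix}0&\mathbf 1'\\ \mathbf 1&\widetilde D\end{bmatrix},\qquad \widetilde D=\mathrm{Circ}(u),\quad u=(0,1,2,\dots,2,1)\in\mathbb{R}^{n-1}.$$ Let $m=\frac{n-1}{2}$. For $k\in\{1,\dots,m\}$ let $c^k\in\mathbb{R}^{n-1}$ be the row vector whose $j$-th entry is $1$ if $j=k+1$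 or $j=n-k$ and $0$ otherwise (for $k=m$ the two positions coincide), and let $C_k=\mathrm{Circ}(c^k)$. Let $$g(k)=\frac{n+(-1)^{m-k}}{2},\qquad \alpha_k=\frac{(-1)^{g(k)}\left(2m^2-6(m-k)^2+1\right)}{6(n-1)}.$$ The special Laplacian of $W_n$ is the $n\times n$ matrix $$\widetilde L=\begin{bmatrix}\frac{n-1}{2}&-\frac12\mathbf 1'\\ -\frac12\mathbf 1&\frac{n(n-2)}{6(n-1)}I_{n-1}+\sum_{k=1}^m\alpha_kC_k\end{bmatrix}.$$ *)

theory Defs
  imports
    "Jordan_Normal_Form.DL_Rank"
    "Graph_Theory.Pair_Digraph"
    "Graph_Theory.Shortest_Path"
begin

text \<open>All matrix and vector indices, and all vertices, are numbered from 0: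
  the vertex \<open>w\<^sub>i\<close> of the wheel graph is the number \<open>i - 1\<close>.\<close>

section \<open>Circulant matrices\<close>

definition circ :: "'a vec \<Rightarrow> 'a mat" where
  "circ x = mat (dim_vec x) (dim_vec x)
     (\<lambda>(i, j). x $ ((j + dim_vec x - i) mod dim_vec x))"

lemma circ_carrier [simp]: "x \<in> carrier_vec r \<Longrightarrow> circ x \<in> carrier_mat r r"
  by (auto simp: circ_def)

lemma circ_first_row: "j < dim_vec x \<Longrightarrow> circ x $$ (0, j) = x $ j"
  by (simp add: circ_def)

lemma circ_shift:
  assumes "Suc i < dim_vec x" "j < dim_vec x"
  shows "circ x $$ (Suc i, Suc j mod dim_vec x) = circ x $$ (i, j)"
proof (cases "Suc j < dim_vec x")
  case True
  then show ?thesis using assms by (simp add: circ_def)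
next
  case False
  then have "Suc j = dim_vec x" using assms by simp
  moreover from this have "j + dim_vec x - i = (dim_vec x - Suc i) + dim_vec x"
    using assms by simp
  ultimately have "(j + dim_vec x - i) mod dim_vec x = dim_vec x - Suc i"
    using assms by (metis mod_add_self2 mod_less diff_less zero_less_Suc gr_zeroI not_less_zero)
  with \<open>Suc j = dim_vec x\<close> show ?thesis using assms by (simp add: circ_def)
qed


section \<open>The wheel graph and its distance matrix\<close>

definition wheel_edges :: "nat \<Rightarrow> (nat \<times> nat) set" where
  "wheel_edges n = {(0, i) | i. 1 \<le> i \<and> i < n}
     \<union> {(i, i + 1) | i. 1 \<le> i \<and> i + 1 < n} \<union> {(n - 1, 1)}"

definition wheel_graph :: "nat \<Rightarrow> nat pair_pre_digraph" where
  "wheel_graph n = \<lparr> pverts = {..<n}, parcs = wheel_edges n \<union> (wheel_edges n)\<inverse> \<rparr>"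

definition graph_dist :: "('a, 'b) pre_digraph \<Rightarrow> 'a \<Rightarrow> 'a \<Rightarrow> real" where
  "graph_dist G u v = real_of_ereal (wf_digraph.\<mu> G (\<lambda>_. 1) u v)"

definition wheel_dist_mat :: "nat \<Rightarrow> real mat" where
  "wheel_dist_mat n = mat n n (\<lambda>(i, j). graph_dist (wheel_graph n) i j)"

lemma wheel_graph_pair_graph:
  assumes "n \<ge> 4"
  shows "pair_graph (wheel_graph n)"
proof
  show "finite (parcs (wheel_graph n))"
    by (rule finite_subset[of _ "{..n} \<times> {..n}"])
       (use assms in \<open>auto simp: wheel_graph_def wheel_edges_def\<close>)
  show "symmetric (wheel_graph n)"
    by (auto simp: symmetric_def wheel_graph_def intro!: symI)
qed (use assms in \<open>auto simp: wheel_graph_def wheel_edges_def\<close>)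

lemma (in wf_digraph) awalk_cost_unit: "awalk_cost (\<lambda>_. 1) p = real (length p)"
  by (induction p) simp_all

lemma (in wf_digraph) graph_dist_eqI:
  assumes "awalk u p v" and "\<And>q. awalk u q v \<Longrightarrow> length p \<le> length q"
  shows "graph_dist G u v = real (length p)"
proof -
  have "\<mu> (\<lambda>_. 1) u v = ereal (real (length p))"
    unfolding \<mu>_def awalk_cost_unit
  proof (rule antisym)
    show "(INF p\<in>{p. awalk u p v}. ereal (real (length p))) \<le> ereal (real (length p))"
      using assms(1) by (auto intro: INF_lower2)
  qed (use assms(2) in \<open>auto intro!: INF_greatest\<close>)
  then show ?thesis by (simp add: graph_dist_def)
qed

lemma wheel_dist:
  assumes n: "n \<ge> 4" and i: "i < n" and j: "j < n"
  shows "graph_dist (wheel_graph n) i j =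
    (if i = j then 0 else if (i, j) \<in> wheel_edges n \<union> (wheel_edges n)\<inverse> then 1 else 2)"
proof -
  interpret W: pair_graph "wheel_graph n" using wheel_graph_pair_graph[OF n] .
  let ?E = "wheel_edges n \<union> (wheel_edges n)\<inverse>"
  have arcs [simp]: "parcs (wheel_graph n) = ?E" and verts [simp]: "pverts (wheel_graph n) = {..<n}"
    by (simp_all add: wheel_graph_def)
  consider "i = j" | "i \<noteq> j" "(i, j) \<in> ?E" | "i \<noteq> j" "(i, j) \<notin> ?E" by blast
  then show ?thesis
  proof cases
    case 1
    have "graph_dist (wheel_graph n) i j = real (length ([] :: (nat \<times> nat) list))"
      by (rule W.graph_dist_eqI) (use 1 i in \<open>auto simp: W.awalk_Nil_iff\<close>)
    with 1 show ?thesis by simp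
  next
    case 2
    have "graph_dist (wheel_graph n) i j = real (length [(i, j)])"
    proof (rule W.graph_dist_eqI)
      show "W.awalk i [(i, j)] j" using 2 i j by (simp add: W.awalk_simps)
      fix q assume "W.awalk i q j"
      then show "length [(i, j)] \<le> length q"
        using 2 by (cases q) (auto simp: W.awalk_Nil_iff)
    qed
    with 2 show ?thesis by simp
  next
    case 3
    have nz: "i \<noteq> 0" "j \<noteq> 0" using 3 i j by (auto simp: wheel_edges_def)
    have "graph_dist (wheel_graph n) i j = real (length [(i, 0), (0, j)])"
    proof (rule W.graph_dist_eqI)
      show "W.awalk i [(i, 0), (0, j)] j"
        using nz i j by (simp add: W.awalk_simps) (auto simp: wheel_edges_def)
      fix q assume q: "W.awalk i q j"
      show "length [(i, 0), (0, j)] \<le> length q"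
      proof (cases q)
        case Nil
        then show ?thesis using q 3 by (auto simp: W.awalk_Nil_iff)
      next
        case (Cons e es)
        then show ?thesis using q 3
          by (cases es; cases e) (auto simp: W.awalk_simps)
      qed
    qed
    with 3 show ?thesis by simp
  qed
qed

definition wheel_u :: "nat \<Rightarrow> real vec" where
  "wheel_u n = vec (n - 1) (\<lambda>j. if j = 0 then 0 else if j = 1 \<or> j = n - 2 then 1 else 2)"

lemma wheel_dist_mat_block:
  assumes n: "n \<ge> 4"
  shows "wheel_dist_mat n =
    four_block_mat (0\<^sub>m 1 1) (mat 1 (n - 1) (\<lambda>_. 1)) (mat (n - 1) 1 (\<lambda>_. 1)) (circ (wheel_u n))"
    (is "_ = ?B")
proof (rule eq_matI)
  fix i j assume "i < dim_row ?B" "j < dim_col ?B"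
  then have i: "i < n" and j: "j < n" using n by (auto simp: circ_def wheel_u_def)
  have L: "wheel_dist_mat n $$ (i, j) =
    (if i = j then 0 else if (i, j) \<in> wheel_edges n \<union> (wheel_edges n)\<inverse> then 1 else 2)"
    using i j by (simp add: wheel_dist_mat_def wheel_dist[OF n])
  consider "i = 0" | "i \<noteq> 0" "j = 0" | "i \<noteq> 0" "j \<noteq> 0" "j \<ge> i" | "i \<noteq> 0" "j \<noteq> 0" "j < i" by linarith
  then show "wheel_dist_mat n $$ (i, j) = ?B $$ (i, j)"
  proof cases
    case 3
    have eq: "(j - 1 + (n - 1) - (i - 1)) mod (n - 1) = j - i"
    proof -
      have "j - 1 + (n - 1) - (i - 1) = (j - i) + (n - 1)" using 3 n by linarith
      moreover have "j - i < n - 1" using 3 j by linarith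
      ultimately show ?thesis by (metis mod_add_self2 mod_less)
    qed
    have "?B $$ (i, j) = wheel_u n $ (j - i)"
      using 3 i j n eq by (simp add: circ_def wheel_u_def)
    then show ?thesis unfolding L using 3 i j n
      by (auto simp: wheel_u_def wheel_edges_def)
  next
    case 4
    have eq: "(j - 1 + (n - 1) - (i - 1)) mod (n - 1) = n - 1 - (i - j)"
    proof -
      have "j - 1 + (n - 1) - (i - 1) = n - 1 - (i - j)" using 4 n i by linarith
      moreover have "n - 1 - (i - j) < n - 1" using 4 n by linarith
      ultimately show ?thesis by simp
    qed
    have "?B $$ (i, j) = wheel_u n $ (n - 1 - (i - j))"
      using 4 i j n eq by (simp add: circ_def wheel_u_def)
    then show ?thesis unfolding L using 4 i j n
      by (auto simp: wheel_u_def wheel_edges_def)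
  qed (use i j n in \<open>auto simp: wheel_dist_mat_def wheel_dist[OF n] wheel_edges_def circ_def wheel_u_def\<close>)
qed (use n in \<open>auto simp: wheel_dist_mat_def circ_def wheel_u_def\<close>)


section \<open>The special Laplacian\<close>

definition wheel_c :: "nat \<Rightarrow> nat \<Rightarrow> real vec" where
  "wheel_c n k = vec (n - 1) (\<lambda>j. if j = k \<or> j = n - k - 1 then 1 else 0)"

text \<open>For odd \<open>n\<close> the division below is exact.\<close>

definition wheel_g :: "nat \<Rightarrow> nat \<Rightarrow> int" where
  "wheel_g n k = (let m = (n - 1) div 2 in (int n + (-1) ^ (m - k)) div 2)"

definition wheel_alpha :: "nat \<Rightarrow> nat \<Rightarrow> real" where
  "wheel_alpha n k = (let m = (n - 1) div 2 in
     (-1) powi (wheel_g n k) * (2 * (real m)\<^sup>2 - 6 * (real m - real k)\<^sup>2 + 1)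
       / (6 * (real n - 1)))"

definition special_laplacian :: "nat \<Rightarrow> real mat" where
  "special_laplacian n = four_block_mat
     (mat 1 1 (\<lambda>_. (real n - 1) / 2))
     (mat 1 (n - 1) (\<lambda>_. - 1 / 2))
     (mat (n - 1) 1 (\<lambda>_. - 1 / 2))
     ((real n * (real n - 2) / (6 * (real n - 1))) \<cdot>\<^sub>m 1\<^sub>m (n - 1)
       + mat (n - 1) (n - 1) (\<lambda>(i, j).
           \<Sum>k = 1..(n - 1) div 2. wheel_alpha n k * circ (wheel_c n k) $$ (i, j)))"

lemma special_laplacian_carrier:
  "n \<ge> 1 \<Longrightarrow> special_laplacian n \<in> carrier_mat n n"
  by (auto simp: special_laplacian_def)


section \<open>Moore--Penrose inverse and positive semidefiniteness\<close>

definition is_moore_penrose :: "real mat \<Rightarrow> real mat \<Rightarrow> bool" where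
  "is_moore_penrose A X \<longleftrightarrow>
     X \<in> carrier_mat (dim_col A) (dim_row A) \<and>
     A * X * A = A \<and> X * A * X = X \<and>
     transpose_mat (A * X) = A * X \<and> transpose_mat (X * A) = X * A"

lemma is_moore_penrose_unique:
  assumes "is_moore_penrose A X" "is_moore_penrose A Y"
  shows "X = Y"
proof -
  define r c where "r = dim_row A" and "c = dim_col A"
  have A [simp]: "A \<in> carrier_mat r c" by (auto simp: r_def c_def)
  have X [simp]: "X \<in> carrier_mat c r" and Y [simp]: "Y \<in> carrier_mat c r"
    using assms by (auto simp: is_moore_penrose_def r_def c_def)
  have x: "A * X * A = A" "X * A * X = X" "transpose_mat (A * X) = A * X"
      "transpose_mat (X * A) = X * A"
    and y: "A * Y * A = A" "Y * A * Y = Y" "transpose_mat (A * Y) = A * Y"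
      "transpose_mat (Y * A) = Y * A"
    using assms by (auto simp: is_moore_penrose_def)
  have AX [simp]: "A * X \<in> carrier_mat r r" and AY [simp]: "A * Y \<in> carrier_mat r r"
    and XA [simp]: "X * A \<in> carrier_mat c c" and YA [simp]: "Y * A \<in> carrier_mat c c"
    using A X Y by (meson mult_carrier_mat)+
  have "A * X = (A * Y * A) * X" by (simp add: y)
  also have "\<dots> = (A * Y) * (A * X)" by (rule assoc_mult_mat[OF AY A X])
  finally have 1: "A * X = (A * Y) * (A * X)" .
  have "transpose_mat ((A * Y) * (A * X)) = (A * X) * (A * Y)"
    by (simp add: transpose_mult[OF AY AX] x y)
  also have "\<dots> = (A * X * A) * Y" by (rule assoc_mult_mat[OF AX A Y, symmetric])
  finally have ax: "A * X = A * Y" using 1 x by metis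
  have "X * A = X * (A * Y * A)" by (simp add: y)
  also have "\<dots> = X * (A * (Y * A))" by (simp add: assoc_mult_mat[OF A Y A])
  also have "\<dots> = (X * A) * (Y * A)" by (rule assoc_mult_mat[OF X A YA, symmetric])
  finally have 2: "X * A = (X * A) * (Y * A)" .
  have "transpose_mat ((X * A) * (Y * A)) = (Y * A) * (X * A)"
    by (simp add: transpose_mult[OF XA YA] x y)
  also have "\<dots> = Y * (A * (X * A))" by (rule assoc_mult_mat[OF Y A XA])
  also have "\<dots> = Y * (A * X * A)" by (simp add: assoc_mult_mat[OF A X A])
  finally have xa: "X * A = Y * A" using 2 x by metis
  have "X = X * A * X" by (simp add: x)
  also have "\<dots> = Y * A * X" by (simp add: xa)
  also have "\<dots> = Y * (A * X)" by (rule assoc_mult_mat[OF Y A X])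
  also have "\<dots> = Y * (A * Y)" by (simp add: ax)
  also have "\<dots> = Y * A * Y" by (rule assoc_mult_mat[OF Y A Y, symmetric])
  finally show ?thesis by (simp add: y)
qed

definition moore_penrose :: "real mat \<Rightarrow> real mat" where
  "moore_penrose A = (THE X. is_moore_penrose A X)"

lemma moore_penrose_eqI: "is_moore_penrose A X \<Longrightarrow> moore_penrose A = X"
  unfolding moore_penrose_def using is_moore_penrose_unique by blast

definition psd_mat :: "real mat \<Rightarrow> bool" where
  "psd_mat A \<longleftrightarrow> square_mat A \<and> transpose_mat A = A \<and>
     (\<forall>v \<in> carrier_vec (dim_row A). 0 \<le> v \<bullet> (A *\<^sub>v v))"

end

theory Submission
  imports Defs
begin

text \<open>Write \<open>n = 2 m + 1\<close>. The rim of the wheel is a cycle of even length \<open>2 m\<close>; let \<open>A\<close> be its adjacency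
matrix and \<open>s\<close> the vector that is zero at the centre and alternates in sign around the rim. Two rim
vertices are at distance 0, 1 or 2, so the rim block of \<open>D\<close> is \<open>2 J - (2 I + A)\<close>, and \<open>2 I + A\<close>
annihilates the alternating vector.

The signs \<open>(-1)\<^sup>g\<close> in the special Laplacian alternate with \<open>k\<close>, and the coefficients are otherwise
samples of a parabola. Applying \<open>2 I + A\<close> to an alternating sequence amounts to taking the second
difference of the sequence stripped of its signs, which is constant for a parabola, apart from the kink where it
closes up around the cycle (\<open>lap_symbol_recurrence\<close>). So the rim block of the Laplacian is
twice the pseudo-inverse of \<open>2 I + A\<close>. Together with two sums over the parabola (\<open>sum_lap_symbol\<close>,
\<open>sum_lap_symbol_alt\<close>) this gives, in \<open>wheel_laplacian_distance_pair\<close>, that \<open>L\<close> kills \<open>1\<close> and \<open>s\<close>,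
that \<open>D\<close> kills \<open>s\<close>, and the identity

\<open>L D = - 2 I + u 1' + s s' / m\<close>

for an explicit vector \<open>u\<close>. Everything else follows from it, in the locale \<open>laplacian_distance_pair\<close>.
Let \<open>P\<close> be the projection onto the complement of \<open>1\<close>. Then \<open>L\<close> times \<open>- P D P / 2\<close> is the orthogonal
projection onto the complement of \<open>1\<close> and \<open>s\<close>, which makes \<open>- P D P / 2\<close> the Moore--Penrose inverse
(\<open>is_moore_penrose_theta\<close>). The distances are recovered since centring drops out of
\<open>\<theta>\<^sub>i\<^sub>i + \<theta>\<^sub>j\<^sub>j - 2 \<theta>\<^sub>i\<^sub>j\<close>; the kernel of \<open>L\<close> is spanned by \<open>1\<close> and \<open>s\<close>, which gives the rank; and
\<open>L = - L D L / 2\<close> is positive semidefinite because \<open>D\<close> is negative semidefinite on vectors with zero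
sum, where its form is minus the sum of \<open>(z\<^sub>i + z\<^sub>i\<^sub>+\<^sub>1)\<^sup>2\<close> over the rim edges.\<close>

section \<open>Rank and kernel\<close>

lemma mat_vec_index_sum:
  assumes "i < dim_row A" "x \<in> carrier_vec (dim_col A)"
  shows "(A *\<^sub>v x) $ i = (\<Sum>j<dim_col A. A $$ (i, j) * x $ j)"
  using assms by (auto simp: scalar_prod_def atLeast0LessThan intro!: sum.cong)

lemma sum_lessThan_plus: "(\<Sum>j<k + d. f j) = (\<Sum>j<k. f j) + (\<Sum>j<d. f (j + k))"
  for f :: "nat \<Rightarrow> 'a :: comm_monoid_add"
  by (induction d) (simp_all add: add.assoc add.commute[of k])

text \<open>The hypotheses say that the kernel is parametrised by its first \<open>k\<close> coordinates. The witnesses in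
\<open>ex\<close> express each of the first \<open>k\<close> columns through the others, and \<open>inj\<close> makes the remaining columns
independent, so these form a basis of the column space.\<close>

lemma (in vec_space) rank_from_kernel_coordinates:
  assumes A: "A \<in> carrier_mat n nc" and k: "k \<le> nc"
    and ex: "\<And>i. i < k \<Longrightarrow> \<exists>x \<in> carrier_vec nc. A *\<^sub>v x = 0\<^sub>v n \<and> (\<forall>j<k. x $ j = (if j = i then 1 else 0))"
    and inj: "\<And>x. x \<in> carrier_vec nc \<Longrightarrow> A *\<^sub>v x = 0\<^sub>v n \<Longrightarrow> (\<And>j. j < k \<Longrightarrow> x $ j = 0) \<Longrightarrow> x = 0\<^sub>v nc"
  shows "rank A = nc - k"
proof -
  define d where "d = nc - k"
  \<comment> \<open>The columns of index at least \<open>k\<close>.\<close>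
  define B where "B = mat n d (\<lambda>(i, j). A $$ (i, j + k))"
  have nc: "nc = k + d" using k by (simp add: d_def)
  have B: "B \<in> carrier_mat n d" by (simp add: B_def)
  have split: "(A *\<^sub>v x) $ i = (\<Sum>j<k. A $$ (i, j) * x $ j) + (B *\<^sub>v vec d (\<lambda>j. x $ (j + k))) $ i"
    if "x \<in> carrier_vec nc" "i < n" for x i
  proof -
    have "(A *\<^sub>v x) $ i = (\<Sum>j<k + d. A $$ (i, j) * x $ j)"
      using A that by (subst mat_vec_index_sum) (auto simp: nc)
    also have "\<dots> = (\<Sum>j<k. A $$ (i, j) * x $ j) + (\<Sum>j<d. A $$ (i, j + k) * x $ (j + k))"
      by (rule sum_lessThan_plus)
    also have "(\<Sum>j<d. A $$ (i, j + k) * x $ (j + k)) = (B *\<^sub>v vec d (\<lambda>j. x $ (j + k))) $ i"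
      using B that by (subst mat_vec_index_sum) (auto simp: B_def)
    finally show ?thesis .
  qed
  \<comment> \<open>A vanishing combination of the last columns is a kernel vector whose first \<open>k\<close> coordinates are zero.\<close>
  have Binj: "v = 0\<^sub>v d" if v: "v \<in> carrier_vec d" and Bv: "B *\<^sub>v v = 0\<^sub>v n" for v
  proof -
    define x where "x = vec nc (\<lambda>j. if j < k then 0 else v $ (j - k))"
    have x: "x \<in> carrier_vec nc" by (simp add: x_def)
    have vx: "vec d (\<lambda>j. x $ (j + k)) = v" using v by (auto simp: x_def nc)
    have xk: "x $ j = 0" if "j < k" for j using that by (simp add: x_def nc)
    have "A *\<^sub>v x = 0\<^sub>v n"
    proof (rule eq_vecI)
      fix i assume "i < dim_vec (0\<^sub>v n :: 'a vec)"
      then show "(A *\<^sub>v x) $ i = 0\<^sub>v n $ i" using split[OF x, of i] by (simp add: vx Bv xk)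
    qed (use A in auto)
    from inj[OF x this xk] have "x = 0\<^sub>v nc" .
    then show ?thesis unfolding vx[symmetric] by (auto simp: nc)
  qed
  have dist: "distinct (cols B)"
  proof (rule ccontr)
    assume "\<not> distinct (cols B)"
    then obtain i j where ij: "i < d" "j < d" "i \<noteq> j" "col B i = col B j"
      using B by (auto simp: distinct_conv_nth)
    have "B *\<^sub>v (unit_vec d i - unit_vec d j) = B *\<^sub>v unit_vec d i - B *\<^sub>v unit_vec d j"
      by (rule mult_minus_distrib_mat_vec[OF B]) auto
    also have "\<dots> = 0\<^sub>v n" proof -
      have "B *\<^sub>v unit_vec d k = col B k" if "k < d" for k
        using that B by (intro eq_vecI) auto
      then show ?thesis using ij B by simp
    qed
    finally have "B *\<^sub>v (unit_vec d i - unit_vec d j) = 0\<^sub>v n" .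
    then have "unit_vec d i - unit_vec d j = (0\<^sub>v d :: 'a vec)" by (rule Binj[rotated]) auto
    then have "(unit_vec d i - unit_vec d j) $ i = (0\<^sub>v d :: 'a vec) $ i" by simp
    then show False using ij by simp
  qed
  have "lin_indpt (set (cols B))"
    using lin_depE[OF B _ dist] Binj by metis
  then have rB: "rank B = d" by (rule lin_indpt_full_rank[OF B dist])
  have colB: "set (cols B) = col A ` {k..<nc}"
  proof -
    have "col B j = col A (j + k)" if "j < d" for j
      using that A B by (auto simp: B_def nc)
    then have "set (cols B) = (\<lambda>j. col A (j + k)) ` {..<d}"
      using B by (auto simp: cols_def)
    also have "\<dots> = col A ` (\<lambda>j. j + k) ` {..<d}" by (simp add: image_image)
    also have "(\<lambda>j. j + k) ` {..<d} = {k..<nc}"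
      by (simp add: lessThan_atLeast0 nc add.commute)
    finally show ?thesis .
  qed
  have carB: "set (cols B) \<subseteq> carrier_vec n" using B cols_dim by blast
  have in_span: "col A i \<in> span (set (cols B))" if i: "i < nc" for i
  proof (cases "i < k")
    case False
    then show ?thesis using i colB carB by (intro span_mem) auto
  next
    case True
    from ex[OF True] obtain x where x: "x \<in> carrier_vec nc" "A *\<^sub>v x = 0\<^sub>v n"
      and xk: "\<And>j. j < k \<Longrightarrow> x $ j = (if j = i then 1 else 0)" by blast
    let ?v = "vec d (\<lambda>j. x $ (j + k))"
    have "col A i = B *\<^sub>v (- ?v)"
    proof (rule eq_vecI)
      fix r assume "r < dim_vec (B *\<^sub>v (- ?v))"
      then have r: "r < n" using B by simp
      have "(\<Sum>j<k. A $$ (r, j) * x $ j) = (\<Sum>j<k. if j = i then A $$ (r, j) else 0)"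
        by (rule sum.cong) (auto simp: xk)
      also have "\<dots> = A $$ (r, i)" using True by simp
      finally have "A $$ (r, i) + (B *\<^sub>v ?v) $ r = 0" using split[OF x(1) r] x(2) r by simp
      moreover have "(B *\<^sub>v (- ?v)) $ r = - (B *\<^sub>v ?v) $ r"
        using B r by simp
      ultimately have "A $$ (r, i) = (B *\<^sub>v (- ?v)) $ r" by (metis eq_neg_iff_add_eq_0)
      then show "col A i $ r = (B *\<^sub>v (- ?v)) $ r"
        using A r i by simp
    qed (use A B in auto)
    moreover have "B *\<^sub>v (- ?v) \<in> col_space B"
      unfolding col_space_eq[OF B] using B by auto
    ultimately show ?thesis unfolding col_space_def by simp
  qed
  have "set (cols A) \<subseteq> span (set (cols B))"
    using A in_span by (auto simp: cols_def)
  then have "span (set (cols A)) \<subseteq> span (set (cols B))" by (rule span_subsetI[OF carB])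
  moreover have "span (set (cols B)) \<subseteq> span (set (cols A))"
    by (rule span_is_monotone) (use A colB in \<open>auto simp: cols_def\<close>)
  ultimately have "rank A = rank B" unfolding rank_def by simp
  with rB show ?thesis by (simp add: d_def)
qed

section \<open>Laplacians inverted by a distance matrix\<close>

definition entry_mat :: "nat \<Rightarrow> (nat \<Rightarrow> nat \<Rightarrow> real) \<Rightarrow> real mat" where
  "entry_mat n f = mat n n (\<lambda>(i, j). f i j)"

lemma entry_mat_mult: "entry_mat n f * entry_mat n g = entry_mat n (\<lambda>i j. \<Sum>k<n. f i k * g k j)"
  by (rule eq_matI) (auto simp: entry_mat_def scalar_prod_def atLeast0LessThan)

lemma entry_mat_mult_vec: "entry_mat n f *\<^sub>v vec n x = vec n (\<lambda>i. \<Sum>k<n. f i k * x k)"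
  by (rule eq_vecI) (auto simp: entry_mat_def scalar_prod_def atLeast0LessThan)

lemma entry_mat_cong: "(\<And>i j. i < n \<Longrightarrow> j < n \<Longrightarrow> f i j = g i j) \<Longrightarrow> entry_mat n f = entry_mat n g"
  by (rule eq_matI) (auto simp: entry_mat_def)

text \<open>The situation abstracted from the wheel: \<open>l\<close> plays the role of a Laplacian, \<open>d\<close> that of a distance
matrix, and \<open>s\<close> is a vector orthogonal to the all-ones vector that both matrices kill. The identity
\<open>ld\<close> reads \<open>L D = - 2 I + u 1' + c s s'\<close>. Multiplied on the right by a matrix whose columns are
orthogonal to \<open>1\<close> and \<open>s\<close>, it retains only the term \<open>- 2 I\<close>, and this is what makes \<open>- D / 2\<close> an
inverse of \<open>L\<close> on the complement of \<open>1\<close> and \<open>s\<close>, up to centring.\<close>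

locale laplacian_distance_pair =
  fixes n :: nat and l d :: "nat \<Rightarrow> nat \<Rightarrow> real" and s u :: "nat \<Rightarrow> real" and c :: real
  assumes n_pos: "n > 0"
    and l_sym: "\<And>i j. l i j = l j i"
    and d_sym: "\<And>i j. d i j = d j i"
    and l_ones: "\<And>i. i < n \<Longrightarrow> (\<Sum>k<n. l i k) = 0"
    and l_s: "\<And>i. i < n \<Longrightarrow> (\<Sum>k<n. l i k * s k) = 0"
    and d_s: "\<And>i. i < n \<Longrightarrow> (\<Sum>k<n. d i k * s k) = 0"
    and s_ones: "(\<Sum>k<n. s k) = 0"
    and ld: "\<And>i j. i < n \<Longrightarrow> j < n \<Longrightarrow>
      (\<Sum>k<n. l i k * d k j) = (if i = j then -2 else 0) + u i + c * s i * s j"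
begin

definition row_mean :: "nat \<Rightarrow> real" where "row_mean i = (\<Sum>k<n. d i k) / real n"

definition total_mean :: real where "total_mean = (\<Sum>i<n. row_mean i) / real n"

text \<open>With \<open>P = I - 1 1' / n\<close>, this is the doubly centred matrix \<open>- P D P / 2\<close>; centring only changes
\<open>d i j\<close> by a term in \<open>i\<close> and a term in \<open>j\<close>.\<close>

definition theta :: "nat \<Rightarrow> nat \<Rightarrow> real" where
  "theta i j = - (d i j - row_mean i - row_mean j + total_mean) / 2"

text \<open>The orthogonal projection onto the complement of \<open>1\<close> and \<open>s\<close>: if \<open>s\<close> is nonzero, \<open>ld\<close> applied to \<open>s\<close> forces
\<open>c / 2 = 1 / (s \<bullet> s)\<close>.\<close>

definition proj :: "nat \<Rightarrow> nat \<Rightarrow> real" where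
  "proj i j = (if i = j then 1 else 0) - 1 / real n - c / 2 * s i * s j"

lemma theta_sym: "theta i j = theta j i"
  by (simp add: theta_def d_sym)

lemma proj_sym: "proj i j = proj j i"
  by (simp add: proj_def)

lemma sum_proj_mult:
  assumes i: "i < n" and f1: "(\<Sum>k<n. f k) = 0" and fs: "(\<Sum>k<n. s k * f k) = 0"
  shows "(\<Sum>k<n. proj i k * f k) = f i"
proof -
  have "(\<Sum>k<n. proj i k * f k) = (\<Sum>k<n. (if k = i then f k else 0) - 1 / real n * f k - c / 2 * s i * (s k * f k))"
    by (rule sum.cong) (auto simp: proj_def algebra_simps)
  also have "\<dots> = (\<Sum>k<n. if k = i then f k else 0) - 1 / real n * (\<Sum>k<n. f k) - c / 2 * s i * (\<Sum>k<n. s k * f k)"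
    by (simp add: sum_subtractf sum_distrib_left)
  finally show ?thesis using i f1 fs by simp
qed

text \<open>Averaging \<open>ld\<close> over \<open>j\<close> recovers \<open>u\<close>; this is how the unspecified vector \<open>u\<close> disappears
from the product with \<open>theta\<close>.\<close>

lemma l_row_mean:
  assumes "i < n"
  shows "(\<Sum>k<n. l i k * row_mean k) = u i - 2 / real n"
proof -
  have "(\<Sum>k<n. l i k * row_mean k) = (\<Sum>k<n. \<Sum>j<n. l i k * d k j) / real n"
    by (simp add: row_mean_def sum_distrib_left sum_divide_distrib)
  also have "(\<Sum>k<n. \<Sum>j<n. l i k * d k j) = (\<Sum>j<n. \<Sum>k<n. l i k * d k j)"
    by (rule sum.swap)
  also have "\<dots> = (\<Sum>j<n. (if i = j then -2 else 0) + u i + c * s i * s j)"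
    by (rule sum.cong) (auto simp: ld assms)
  also have "\<dots> = -2 + real n * u i + c * s i * (\<Sum>j<n. s j)"
    using assms by (simp add: sum.distrib sum_distrib_left)
  finally show ?thesis using n_pos s_ones by (simp add: field_simps)
qed

lemma l_theta:
  assumes "i < n" "j < n"
  shows "(\<Sum>k<n. l i k * theta k j) = proj i j"
proof -
  have "(\<Sum>k<n. l i k * theta k j) = (\<Sum>k<n. -1/2 * (l i k * d k j) + 1/2 * (l i k * row_mean k) + (row_mean j - total_mean) / 2 * l i k)"
    by (rule sum.cong) (auto simp: theta_def field_simps)
  also have "\<dots> = -1/2 * (\<Sum>k<n. l i k * d k j) + 1/2 * (\<Sum>k<n. l i k * row_mean k) + (row_mean j - total_mean) / 2 * (\<Sum>k<n. l i k)"
    by (simp only: sum.distrib sum_distrib_left)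
  finally show ?thesis unfolding ld[OF assms] l_row_mean[OF assms(1)] l_ones[OF assms(1)] proj_def
    by (simp add: add_divide_distrib diff_divide_distrib)
qed

lemma theta_ones:
  assumes "i < n"
  shows "(\<Sum>k<n. theta i k) = 0"
proof -
  have "(\<Sum>k<n. theta i k) = (\<Sum>k<n. -1/2 * d i k + 1/2 * row_mean k + (row_mean i - total_mean) / 2)"
    by (rule sum.cong) (auto simp: theta_def field_simps)
  also have "\<dots> = -1/2 * (\<Sum>k<n. d i k) + 1/2 * (\<Sum>k<n. row_mean k) + real n * ((row_mean i - total_mean) / 2)"
    by (simp add: sum.distrib sum_distrib_left[symmetric] sum_divide_distrib[symmetric] sum_negf sum_subtractf diff_divide_distrib)
  also have "(\<Sum>k<n. d i k) = real n * row_mean i" using n_pos by (simp add: row_mean_def)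
  also have "(\<Sum>k<n. row_mean k) = real n * total_mean" using n_pos by (simp add: total_mean_def)
  finally show ?thesis by (simp add: field_simps)
qed

lemma theta_s:
  assumes i: "i < n"
  shows "(\<Sum>k<n. theta i k * s k) = 0"
proof -
  have "(\<Sum>k<n. row_mean k * s k) = (\<Sum>k<n. \<Sum>j<n. d k j * s k) / real n"
    by (simp add: row_mean_def sum_distrib_right sum_divide_distrib)
  also have "(\<Sum>k<n. \<Sum>j<n. d k j * s k) = (\<Sum>j<n. \<Sum>k<n. d j k * s k)"
    by (subst sum.swap) (simp add: d_sym)
  finally have rs: "(\<Sum>k<n. row_mean k * s k) = 0" by (simp add: d_s)
  have "(\<Sum>k<n. theta i k * s k) = (\<Sum>k<n. -1/2 * (d i k * s k) + 1/2 * (row_mean k * s k) + (row_mean i - total_mean) / 2 * s k)"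
    by (rule sum.cong) (auto simp: theta_def field_simps)
  also have "\<dots> = -1/2 * (\<Sum>k<n. d i k * s k) + 1/2 * (\<Sum>k<n. row_mean k * s k) + (row_mean i - total_mean) / 2 * (\<Sum>k<n. s k)"
    by (simp only: sum.distrib sum_distrib_left)
  finally show ?thesis using i by (simp add: d_s rs s_ones)
qed

lemma theta_l:
  assumes "i < n" "j < n"
  shows "(\<Sum>k<n. theta i k * l k j) = proj i j"
  using l_theta[OF assms(2,1)] by (simp add: proj_sym theta_sym[of i] l_sym[of _ j] mult.commute)

text \<open>Both products of \<open>l\<close> and \<open>theta\<close> are the symmetric matrix \<open>proj\<close>. It acts as the identity on the
columns of \<open>l\<close> and of \<open>theta\<close>, because these are orthogonal to \<open>1\<close> and to \<open>s\<close>.\<close>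

lemma is_moore_penrose_theta: "is_moore_penrose (entry_mat n l) (entry_mat n theta)"
proof -
  have LT: "entry_mat n l * entry_mat n theta = entry_mat n proj"
    unfolding entry_mat_mult by (rule entry_mat_cong) (rule l_theta)
  have TL: "entry_mat n theta * entry_mat n l = entry_mat n proj"
    unfolding entry_mat_mult by (rule entry_mat_cong) (rule theta_l)
  have QL: "entry_mat n proj * entry_mat n l = entry_mat n l"
    unfolding entry_mat_mult
  proof (rule entry_mat_cong)
    fix i j assume ij: "i < n" "j < n"
    show "(\<Sum>k<n. proj i k * l k j) = l i j"
      using l_ones[OF ij(2)] l_s[OF ij(2)]
      by (intro sum_proj_mult ij(1)) (simp_all add: l_sym[of _ j] mult.commute)
  qed
  have QT: "entry_mat n proj * entry_mat n theta = entry_mat n theta"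
    unfolding entry_mat_mult
  proof (rule entry_mat_cong)
    fix i j assume ij: "i < n" "j < n"
    show "(\<Sum>k<n. proj i k * theta k j) = theta i j"
      using theta_ones[OF ij(2)] theta_s[OF ij(2)]
      by (intro sum_proj_mult ij(1)) (simp_all add: theta_sym[of _ j] mult.commute)
  qed
  have "transpose_mat (entry_mat n proj) = entry_mat n proj"
    by (rule eq_matI) (auto simp: entry_mat_def proj_sym)
  then show ?thesis
    unfolding is_moore_penrose_def LT TL QL QT by (simp add: entry_mat_def)
qed

text \<open>The centring terms cancel in this combination, as they do for any matrix of the form
\<open>d i j - a i - a j + b\<close>.\<close>

lemma theta_distance:
  assumes "d i i = 0" "d j j = 0"
  shows "theta i i + theta j j - 2 * theta i j = d i j"
  using assms by (simp add: theta_def field_simps)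

text \<open>If \<open>L x = 0\<close>, then the projection of \<open>x\<close>, being \<open>theta\<close> applied to \<open>L x\<close>, vanishes; so \<open>x\<close>
lies in the span of \<open>1\<close> and \<open>s\<close>.\<close>

lemma kernel_span:
  assumes x: "\<And>i. i < n \<Longrightarrow> (\<Sum>k<n. l i k * x k) = 0" and j: "j < n"
  shows "x j = (\<Sum>k<n. x k) / real n + c / 2 * (\<Sum>k<n. s k * x k) * s j"
proof -
  have "(\<Sum>k<n. proj j k * x k) = (\<Sum>k<n. \<Sum>i<n. theta j i * (l i k * x k))"
    by (rule sum.cong) (auto simp: theta_l[OF j, symmetric] sum_distrib_right mult.assoc)
  also have "\<dots> = (\<Sum>i<n. theta j i * (\<Sum>k<n. l i k * x k))"
    by (subst sum.swap) (simp add: sum_distrib_left)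
  also have "\<dots> = 0" by (simp add: x)
  also have "(\<Sum>k<n. proj j k * x k) = (\<Sum>k<n. (if k = j then x k else 0) - 1 / real n * x k - c / 2 * s j * (s k * x k))"
    by (rule sum.cong) (auto simp: proj_def algebra_simps)
  also have "\<dots> = x j - 1 / real n * (\<Sum>k<n. x k) - c / 2 * s j * (\<Sum>k<n. s k * x k)"
    using j by (simp add: sum_subtractf sum_distrib_left)
  finally show ?thesis by (simp add: algebra_simps)
qed

text \<open>Since \<open>1\<close> and \<open>s\<close> are orthogonal to the range of \<open>L\<close>, the identity \<open>ld\<close> gives \<open>L D L = - 2 L\<close>.
Thus the quadratic form of \<open>L\<close> is, up to a negative factor, that of \<open>D\<close> evaluated on vectors
with zero sum.\<close>

lemma quadratic_form:
  fixes v :: "nat \<Rightarrow> real"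
  defines "z \<equiv> \<lambda>i. \<Sum>k<n. l i k * v k"
  shows "(\<Sum>i<n. v i * z i) = - (\<Sum>i<n. \<Sum>j<n. z i * d i j * z j) / 2"
    and "(\<Sum>i<n. z i) = 0"
proof -
  have orth: "(\<Sum>i<n. f i * z i) = 0" if "\<And>k. k < n \<Longrightarrow> (\<Sum>i<n. l k i * f i) = 0" for f
  proof -
    have "(\<Sum>i<n. f i * z i) = (\<Sum>k<n. \<Sum>i<n. v k * (l k i * f i))"
      unfolding z_def sum_distrib_left
      by (subst sum.swap) (simp add: l_sym mult_ac)
    also have "\<dots> = (\<Sum>k<n. v k * (\<Sum>i<n. l k i * f i))" by (simp add: sum_distrib_left)
    finally show ?thesis by (simp add: that)
  qed
  show z1: "(\<Sum>i<n. z i) = 0" using orth[of "\<lambda>_. 1"] by (simp add: l_ones)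
  have zs: "(\<Sum>i<n. s i * z i) = 0" by (rule orth) (rule l_s)
  have zd: "(\<Sum>i<n. z i * d i j) = (\<Sum>k<n. v k * (\<Sum>i<n. l k i * d i j))" for j
    unfolding z_def sum_distrib_left sum_distrib_right
    by (subst sum.swap) (simp add: l_sym mult_ac)
  have ldz: "(\<Sum>j<n. (\<Sum>i<n. l k i * d i j) * z j) = -2 * z k" if k: "k < n" for k
  proof -
    have "(\<Sum>j<n. (\<Sum>i<n. l k i * d i j) * z j)
        = (\<Sum>j<n. (if j = k then -2 * z j else 0) + u k * z j + c * s k * (s j * z j))"
    proof (rule sum.cong)
      fix j assume "j \<in> {..<n}"
      then have "(\<Sum>i<n. l k i * d i j) = (if k = j then -2 else 0) + u k + c * s k * s j"
        using k by (simp only: ld lessThan_iff)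
      then show "(\<Sum>i<n. l k i * d i j) * z j = (if j = k then -2 * z j else 0) + u k * z j + c * s k * (s j * z j)"
        by (simp only:) (simp add: algebra_simps)
    qed simp
    also have "\<dots> = -2 * z k + u k * (\<Sum>j<n. z j) + c * s k * (\<Sum>j<n. s j * z j)"
      using k by (simp add: sum.distrib sum_distrib_left)
    finally show ?thesis by (simp add: z1 zs)
  qed
  have "(\<Sum>i<n. \<Sum>j<n. z i * d i j * z j) = (\<Sum>j<n. (\<Sum>i<n. z i * d i j) * z j)"
    by (subst sum.swap) (simp add: sum_distrib_right)
  also have "\<dots> = (\<Sum>k<n. v k * (\<Sum>j<n. (\<Sum>i<n. l k i * d i j) * z j))"
    unfolding zd sum_distrib_left sum_distrib_right
    by (subst sum.swap) (simp add: mult_ac)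
  also have "\<dots> = -2 * (\<Sum>k<n. v k * z k)"
    using ldz by (simp add: sum_distrib_left[symmetric] mult.left_commute[of _ 2] sum_negf)
  finally show "(\<Sum>i<n. v i * z i) = - (\<Sum>i<n. \<Sum>j<n. z i * d i j * z j) / 2" by simp
qed

text \<open>A kernel vector \<open>a 1 + b s\<close> is determined by its entries \<open>a\<close> and \<open>a + b s\<^sub>1\<close> at the positions 0
and 1.\<close>

lemma rank_laplacian:
  assumes n2: "n \<ge> 2" and s0: "s 0 = 0" and s1: "s 1 \<noteq> 0"
  shows "vec_space.rank n (entry_mat n l) = n - 2"
proof (rule vec_space.rank_from_kernel_coordinates[OF _ n2])
  show "entry_mat n l \<in> carrier_mat n n" by (simp add: entry_mat_def)
  have less2: "k < 2 \<longleftrightarrow> k = 0 \<or> k = Suc 0" for k :: nat by auto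
  fix i :: nat assume "i < 2"
  then consider "i = 0" | "i = 1" by linarith
  then show "\<exists>x\<in>carrier_vec n. entry_mat n l *\<^sub>v x = 0\<^sub>v n \<and> (\<forall>j<2. x $ j = (if j = i then 1 else 0))"
  proof cases
    case 1
    define x where "x = (\<lambda>k. 1 - s k / s 1)"
    have "(\<Sum>k<n. l i k * x k) = (\<Sum>k<n. l i k) - (\<Sum>k<n. l i k * s k) / s 1" for i
      by (simp add: x_def algebra_simps sum_subtractf sum_divide_distrib)
    then have "entry_mat n l *\<^sub>v vec n x = 0\<^sub>v n"
      unfolding entry_mat_mult_vec by (intro eq_vecI) (simp_all add: l_ones l_s)
    then show ?thesis using 1 n2 s0 s1
      by (intro bexI[of _ "vec n x"]) (auto simp: x_def less2)
  next
    case 2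
    define x where "x = (\<lambda>k. s k / s 1)"
    have "(\<Sum>k<n. l i k * x k) = (\<Sum>k<n. l i k * s k) / s 1" for i
      by (simp add: x_def sum_divide_distrib)
    then have "entry_mat n l *\<^sub>v vec n x = 0\<^sub>v n"
      unfolding entry_mat_mult_vec by (intro eq_vecI) (simp_all add: l_s)
    then show ?thesis using 2 n2 s0 s1
      by (intro bexI[of _ "vec n x"]) (auto simp: x_def less2)
  qed
next
  fix x :: "real vec"
  assume x: "x \<in> carrier_vec n" and lx: "entry_mat n l *\<^sub>v x = 0\<^sub>v n" and z: "\<And>j. j < 2 \<Longrightarrow> x $ j = 0"
  have xv: "vec n (($) x) = x" using x by auto
  have "(\<Sum>k<n. l i k * x $ k) = 0" if "i < n" for i
    using arg_cong[OF lx, of "\<lambda>v. v $ i"] that entry_mat_mult_vec[of n l "($) x"] by (simp add: xv)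
  from kernel_span[of "($) x", OF this] obtain a b where ab: "x $ j = a + b * s j" if "j < n" for j
    by blast
  have "a = 0" using ab[of 0] z[of 0] n2 s0 by simp
  moreover have "b = 0" using ab[of 1] z[of 1] n2 s1 \<open>a = 0\<close> by simp
  ultimately show "x = 0\<^sub>v n" using ab x by (intro eq_vecI) auto
qed

lemma psd_laplacian:
  assumes d_nonpos: "\<And>z. (\<Sum>i<n. z i) = 0 \<Longrightarrow> (\<Sum>i<n. \<Sum>j<n. z i * d i j * z j) \<le> 0"
  shows "psd_mat (entry_mat n l)"
  unfolding psd_mat_def
proof (intro conjI ballI)
  show "square_mat (entry_mat n l)" by (simp add: entry_mat_def)
  show "transpose_mat (entry_mat n l) = entry_mat n l"
    by (rule eq_matI) (auto simp: entry_mat_def l_sym)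
  fix v :: "real vec" assume "v \<in> carrier_vec (dim_row (entry_mat n l))"
  then have v: "v \<in> carrier_vec n" by (simp add: entry_mat_def)
  define z where "z i = (\<Sum>k<n. l i k * v $ k)" for i
  have vv: "vec n (($) v) = v" using v by auto
  have "entry_mat n l *\<^sub>v v = vec n z"
    using entry_mat_mult_vec[of n l "($) v"] unfolding vv z_def .
  then have "v \<bullet> (entry_mat n l *\<^sub>v v) = (\<Sum>i<n. v $ i * z i)"
    by (simp add: scalar_prod_def atLeast0LessThan)
  also have "\<dots> = - (\<Sum>i<n. \<Sum>j<n. z i * d i j * z j) / 2"
    unfolding z_def by (rule quadratic_form(1))
  also have "\<dots> \<ge> 0"
    using d_nonpos[of z] quadratic_form(2)[of "($) v"] by (simp add: z_def)
  finally show "0 \<le> v \<bullet> (entry_mat n l *\<^sub>v v)" .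
qed

end

section \<open>Symbols of circulant matrices\<close>

text \<open>A circulant matrix of size \<open>N\<close> has entries \<open>F (j - i)\<close> with an \<open>N\<close>-periodic function \<open>F\<close> on the
integers, its symbol. Working with symbols replaces index arithmetic modulo \<open>N\<close> by ordinary integer
arithmetic.\<close>

definition periodic :: "nat \<Rightarrow> (int \<Rightarrow> real) \<Rightarrow> bool" where
  "periodic N F \<longleftrightarrow> (\<forall>a b. a mod int N = b mod int N \<longrightarrow> F a = F b)"

lemma periodicD: "periodic N F \<Longrightarrow> a mod int N = b mod int N \<Longrightarrow> F a = F b"
  unfolding periodic_def by blast

lemma periodic_shift: "periodic N F \<Longrightarrow> periodic N (\<lambda>k. F (k + c))"
  unfolding periodic_def by (blast intro: mod_add_cong)

lemma periodic_mult: "periodic N F \<Longrightarrow> periodic N G \<Longrightarrow> periodic N (\<lambda>k. F k * G k)"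
  unfolding periodic_def by (intro allI impI arg_cong2[of _ _ _ _ "(*)"]) blast+

lemma sum_period_shift:
  assumes F: "periodic N F"
  shows "(\<Sum>k = 1..N. F (int k + c)) = (\<Sum>k = 1..N. F (int k))"
proof -
  have step: "(\<Sum>k = 1..N. F (int k + (c + 1))) = (\<Sum>k = 1..N. F (int k + c))" for c
  proof -
    have "(\<Sum>k = 1..N. F (int k + (c + 1))) = (\<Sum>k<N. F (int (Suc k) + c + 1))"
      by (rule sum.reindex_bij_witness[of _ Suc "\<lambda>k. k - 1"]) (auto simp: algebra_simps)
    moreover have "(\<Sum>k = 1..N. F (int k + c)) = (\<Sum>k<N. F (int k + c + 1))"
      by (rule sum.reindex_bij_witness[of _ Suc "\<lambda>k. k - 1"]) (auto simp: algebra_simps)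
    moreover have "(\<Sum>k<N. F (int (Suc k) + c + 1)) - (\<Sum>k<N. F (int k + c + 1)) = F (int N + c + 1) - F (c + 1)"
      unfolding sum_subtractf[symmetric] sum_lessThan_telescope[of "\<lambda>k. F (int k + c + 1)"] by simp
    moreover have "F (int N + c + 1) = F (c + 1)" by (rule periodicD[OF F]) (simp add: add.assoc)
    ultimately show ?thesis by simp
  qed
  show ?thesis
  proof (induction c rule: int_induct[of _ 0])
    case (step1 c)
    then show ?case by (simp only: step)
  next
    case (step2 c)
    then show ?case using step[of "c - 1"] by simp
  qed simp
qed

lemma sum_period_lessThan:
  assumes F: "periodic N F"
  shows "(\<Sum>k = 1..N. F (int k)) = (\<Sum>k<N. F (int k))"
proof -
  have "(\<Sum>k<N. F (int k)) = (\<Sum>k = 1..N. F (int k + (-1)))"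
    by (rule sum.reindex_bij_witness[of _ "\<lambda>k. k - 1" Suc]) auto
  also have "\<dots> = (\<Sum>k = 1..N. F (int k))" by (rule sum_period_shift[OF F])
  finally show ?thesis ..
qed

definition dirac :: "nat \<Rightarrow> int \<Rightarrow> real" where
  "dirac N t = (if int N dvd t then 1 else 0)"

lemma dirac_minus: "dirac N (a - b) = dirac N (b - a)"
  by (simp add: dirac_def dvd_diff_commute)

lemma sum_mult_dirac:
  assumes F: "periodic N F" and N: "N > 0"
  shows "(\<Sum>k = 1..N. F (int k) * dirac N (int k - c)) = F c"
proof -
  define k0 where "k0 = nat ((c - 1) mod int N) + 1"
  have k0: "int k0 = (c - 1) mod int N + 1" using N by (simp add: k0_def)
  have r: "0 \<le> (c - 1) mod int N" "(c - 1) mod int N < int N" using N by simp_all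
  have mem: "k0 \<in> {1..N}" using r k0 by auto
  have k0c: "int k0 mod int N = c mod int N" unfolding k0 by (simp add: mod_simps)
  have iff: "int N dvd int k - c \<longleftrightarrow> k = k0" if k: "k \<in> {1..N}" for k
  proof
    assume "int N dvd int k - c"
    then have "(int k - 1) mod int N = (c - 1) mod int N"
      by (simp add: mod_eq_dvd_iff)
    moreover have "(int k - 1) mod int N = int k - 1" using k by simp
    ultimately show "k = k0" using k0 by linarith
  qed (use k0c in \<open>simp add: mod_eq_dvd_iff\<close>)
  have "(\<Sum>k = 1..N. F (int k) * dirac N (int k - c)) = (\<Sum>k = 1..N. if k = k0 then F (int k) else 0)"
    by (rule sum.cong) (auto simp: dirac_def iff)
  also have "\<dots> = F (int k0)" using mem by (simp only: sum.delta finite_atLeastAtMost if_True)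
  also have "\<dots> = F c" by (rule periodicD[OF F k0c])
  finally show ?thesis .
qed

text \<open>The symbol of \<open>2 I + A\<close>, where \<open>A\<close> is the adjacency matrix of the cycle of length \<open>N\<close> (its signless
Laplacian).\<close>

definition signless :: "nat \<Rightarrow> int \<Rightarrow> real" where
  "signless N t = 2 * dirac N t + dirac N (t - 1) + dirac N (t + 1)"

lemma sum_mult_signless:
  assumes F: "periodic N F" and N: "N > 0"
  shows "(\<Sum>k = 1..N. F (int k) * signless N (c - int k)) = 2 * F c + F (c + 1) + F (c - 1)"
proof -
  have "signless N (c - int k) = 2 * dirac N (int k - c) + dirac N (int k - (c + 1)) + dirac N (int k - (c - 1))" for k
  proof -
    have "c - int k - 1 = (c - 1) - int k" "c - int k + 1 = (c + 1) - int k" by simp_all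
    then show ?thesis unfolding signless_def by (simp only: dirac_minus[of N _ "int k"])
  qed
  then have "(\<Sum>k = 1..N. F (int k) * signless N (c - int k)) =
     2 * (\<Sum>k = 1..N. F (int k) * dirac N (int k - c)) + (\<Sum>k = 1..N. F (int k) * dirac N (int k - (c + 1)))
     + (\<Sum>k = 1..N. F (int k) * dirac N (int k - (c - 1)))"
    by (simp add: sum.distrib sum_distrib_left algebra_simps)
  then show ?thesis by (simp only: sum_mult_dirac[OF F N])
qed

text \<open>The form equals the sum of \<open>(z\<^sub>i + z\<^sub>i\<^sub>+\<^sub>1)\<^sup>2\<close> over the edges of the cycle.\<close>

lemma signless_quadratic_form_nonneg:
  assumes N: "N > 0"
  shows "0 \<le> (\<Sum>i = 1..N. \<Sum>j = 1..N. z i * signless N (int i - int j) * z j)"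
proof -
  \<comment> \<open>Extending \<open>z\<close> periodically lets the neighbours of the end points be written as \<open>i + 1\<close> and \<open>i - 1\<close>.\<close>
  define Z where "Z k = z (nat ((k - 1) mod int N) + 1)" for k
  have Z: "periodic N Z" unfolding periodic_def Z_def
    by (auto dest: mod_diff_cong[OF _ refl, of _ _ _ 1])
  have zZ: "z k = Z (int k)" if "k \<in> {1..N}" for k
    using that by (auto simp: Z_def nat_diff_distrib)
  note per = periodic_mult[OF Z Z] periodic_mult[OF Z periodic_shift[OF Z, of 1]]
  have sq: "(\<Sum>i = 1..N. Z (int i + 1) * Z (int i + 1)) = (\<Sum>i = 1..N. Z (int i) * Z (int i))"
    by (rule sum_period_shift[OF per(1)])
  have cross: "(\<Sum>i = 1..N. Z (int i) * Z (int i - 1)) = (\<Sum>i = 1..N. Z (int i) * Z (int i + 1))"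
    using sum_period_shift[OF per(2), of "-1"] by (simp add: mult.commute)
  have "(\<Sum>i = 1..N. \<Sum>j = 1..N. z i * signless N (int i - int j) * z j)
      = (\<Sum>i = 1..N. Z (int i) * (\<Sum>j = 1..N. Z (int j) * signless N (int i - int j)))"
    by (simp add: zZ sum_distrib_left mult_ac)
  also have "\<dots> = 2 * (\<Sum>i = 1..N. Z (int i) * Z (int i)) + (\<Sum>i = 1..N. Z (int i) * Z (int i + 1))
      + (\<Sum>i = 1..N. Z (int i) * Z (int i - 1))"
    by (simp only: sum_mult_signless[OF Z N]) (simp add: algebra_simps sum.distrib sum_distrib_left)
  also have "\<dots> = (\<Sum>i = 1..N. (Z (int i) + Z (int i + 1))\<^sup>2)"
    unfolding cross using sq by (simp add: power2_eq_square algebra_simps sum.distrib sum_distrib_left)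
  also have "\<dots> \<ge> 0" by (rule sum_nonneg) simp
  finally show ?thesis .
qed

definition alt :: "int \<Rightarrow> real" where "alt k = (if even k then 1 else -1)"

lemma alt_simps [simp]: "alt (k + 1) = - alt k" "alt (1 + k) = - alt k" "alt (k - 1) = - alt k" "alt k * alt k = 1"
  by (auto simp: alt_def)

lemma alt_diff: "alt (a - b) = alt a * alt b"
  by (auto simp: alt_def)

lemma periodic_alt:
  assumes "even N"
  shows "periodic N alt"
proof -
  have "alt a = alt b" if "a mod int N = b mod int N" for a b
  proof -
    have "even a \<longleftrightarrow> even b" using that assms by (metis dvd_mod_iff even_of_nat)
    then show ?thesis by (simp add: alt_def)
  qed
  then show ?thesis unfolding periodic_def by blast
qed

lemma sum_alt: "even N \<Longrightarrow> (\<Sum>k = 1..N. alt (int k)) = 0"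
proof -
  have "(\<Sum>k = 1..N. alt (int k)) = (if even N then 0 else -1)" for N
    by (induction N) (auto simp: alt_def)
  then show "even N \<Longrightarrow> ?thesis" by simp
qed

text \<open>At integers \<open>k\<close> between 1 and \<open>m\<close> this is \<open>\<alpha>\<^sub>k\<close> without the factor \<open>(-1)\<^sup>g\<close>.\<close>

definition parabola :: "nat \<Rightarrow> real \<Rightarrow> real" where
  "parabola m x = (2 * (real m)\<^sup>2 + 1 - 6 * (real m - x)\<^sup>2) / (12 * real m)"

text \<open>The symbol of the rim block of the special Laplacian. The exponent \<open>g k\<close> has the parity of \<open>k + 1\<close>,
so the coefficients are samples of a parabola with alternating sign; the parabola is symmetric about
\<open>m\<close>, hence continues periodically past \<open>2 m\<close>, with a kink at the multiples of \<open>2 m\<close>. The value at 0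
is exactly the diagonal coefficient.\<close>

definition lap_symbol :: "nat \<Rightarrow> int \<Rightarrow> real" where
  "lap_symbol m k = - alt k * parabola m (of_int (k mod int (2 * m)))"

lemma periodic_lap_symbol: "periodic (2 * m) (lap_symbol m)"
proof -
  have "lap_symbol m a = lap_symbol m b" if "a mod int (2 * m) = b mod int (2 * m)" for a b
    unfolding lap_symbol_def that periodicD[OF periodic_alt that, simplified] ..
  then show ?thesis unfolding periodic_def by blast
qed

lemma parabola_reflect: "parabola m (2 * real m - x) = parabola m x"
proof -
  have "(real m - (2 * real m - x))\<^sup>2 = (real m - x)\<^sup>2" by (simp add: power2_eq_square algebra_simps)
  then show ?thesis by (simp only: parabola_def)
qed

lemma parabola_second_difference:
  "2 * parabola m x - parabola m (x + 1) - parabola m (x - 1) = 1 / real m"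
proof -
  have "2 * (c - 6 * (M - x)\<^sup>2) - (c - 6 * (M - (x + 1))\<^sup>2) - (c - 6 * (M - (x - 1))\<^sup>2) = 12" for c M :: real
    by (simp add: power2_eq_square algebra_simps)
  then have "2 * parabola m x - parabola m (x + 1) - parabola m (x - 1) = 12 / (12 * real m)"
    by (simp only: parabola_def add_divide_distrib[symmetric] diff_divide_distrib[symmetric] times_divide_eq_right)
  then show ?thesis by simp
qed

lemma parabola_first_difference:
  assumes "m > 0"
  shows "parabola m 1 - parabola m 0 = 1 - 1 / (2 * real m)"
proof -
  have "(c - 6 * (M - 1)\<^sup>2) - (c - 6 * (M - 0)\<^sup>2) = 12 * M - 6" for c M :: real
    by (simp add: power2_eq_square algebra_simps)
  then have "parabola m 1 - parabola m 0 = (12 * real m - 6) / (12 * real m)"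
    by (simp only: parabola_def diff_divide_distrib[symmetric])
  then show ?thesis using assms by (simp add: diff_divide_distrib)
qed

text \<open>Because of the alternating sign, \<open>2 I + A\<close> acts on the symbol, up to sign, as the second
difference does on the parabola. The second difference is constant, except for the contribution of the kink at 0. In matrix
form, \<open>(2 I + A) M = 2 I - s s' / m\<close> for the rim block \<open>M\<close> and the alternating vector \<open>s\<close>.\<close>

lemma lap_symbol_recurrence:
  assumes m: "m > 0"
  shows "2 * lap_symbol m k + lap_symbol m (k + 1) + lap_symbol m (k - 1)
    = 2 * dirac (2 * m) k - alt k / real m"
proof -
  define r where "r = k mod int (2 * m)"
  have r: "0 \<le> r" "r < 2 * int m" using m by (simp_all add: r_def)
  \<comment> \<open>At the end of a period the symmetry of the parabola replaces the value at 0 by the value at \<open>2 m\<close>.\<close>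
  have up: "parabola m (of_int ((k + 1) mod int (2 * m))) = parabola m (of_int r + 1)"
  proof -
    have "(k + 1) mod int (2 * m) = (r + 1) mod int (2 * m)" by (simp add: r_def mod_simps)
    also have "\<dots> = (if r + 1 = 2 * int m then 0 else r + 1)" using r by auto
    finally have mod: "(k + 1) mod int (2 * m) = (if r + 1 = 2 * int m then 0 else r + 1)" .
    show ?thesis
    proof (cases "r + 1 = 2 * int m")
      case True
      then have eq: "of_int r + 1 = 2 * real m" by linarith
      show ?thesis unfolding mod eq using parabola_reflect[of m 0] True by simp
    next
      case False
      then show ?thesis unfolding mod by simp
    qed
  qed
  have dirac: "dirac (2 * m) k = (if r = 0 then 1 else 0)"
    by (simp add: dirac_def r_def dvd_eq_mod_eq_0)
  have down: "(k - 1) mod int (2 * m) = (r - 1) mod int (2 * m)" by (simp add: r_def mod_simps)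
  have "2 * parabola m r - parabola m (of_int r + 1) - parabola m (of_int ((k - 1) mod int (2 * m)))
     = (if r = 0 then -2 else 0) + 1 / real m"
  proof (cases "r = 0")
    case True
    have "(r - 1) mod int (2 * m) = 2 * int m - 1"
      using True m by (simp add: zmod_minus1)
    then have "parabola m (of_int ((k - 1) mod int (2 * m))) = parabola m 1"
      using parabola_reflect[of m 1] unfolding down by simp
    then have "2 * parabola m r - parabola m (of_int r + 1) - parabola m (of_int ((k - 1) mod int (2 * m)))
      = 2 * (parabola m 0 - parabola m 1)" using True by simp
    then show ?thesis using True parabola_first_difference[OF m] by simp
  next
    case False
    have "(r - 1) mod int (2 * m) = r - 1" using False r by simp
    then have "parabola m (of_int ((k - 1) mod int (2 * m))) = parabola m (of_int r - 1)" unfolding down by simp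
    then show ?thesis using False parabola_second_difference[of m "of_int r"] by simp
  qed
  moreover have "alt k = 1" if "r = 0"
    using that by (auto simp: r_def alt_def)
  moreover have "2 * lap_symbol m k + lap_symbol m (k + 1) + lap_symbol m (k - 1)
    = - alt k * (2 * parabola m r - parabola m (of_int r + 1) - parabola m (of_int ((k - 1) mod int (2 * m))))"
    unfolding lap_symbol_def up r_def[symmetric] by (simp add: algebra_simps)
  ultimately show ?thesis unfolding dirac by (auto simp: algebra_simps)
qed

text \<open>Summation of an alternating sequence: the quadratic polynomial \<open>Q\<close> solves
\<open>Q k + Q (k + 1) = 2 num k\<close>, so the sum telescopes.\<close>

lemma sum_lap_symbol:
  assumes m: "m > 0"
  shows "(\<Sum>k = 1..2 * m. lap_symbol m (int k)) = 1 / 2"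
proof -
  define M where "M = real m"
  define num where "num x = 2 * M\<^sup>2 + 1 - 6 * (M - x)\<^sup>2" for x
  define Q where "Q x = num x - 6 * (M - x)" for x
  have tele: "(\<Sum>k<K. alt (int k) * (2 * num (real k))) = Q 0 - alt (int K) * Q (real K)" for K
  proof (induction K)
    case (Suc K)
    have "2 * num (real K) = Q (real K) + Q (real K + 1)"
      by (simp add: num_def Q_def algebra_simps power2_eq_square)
    moreover have "alt (int (Suc K)) = - alt (int K)" by (simp add: add.commute[of 1])
    moreover have "real (Suc K) = real K + 1" by simp
    ultimately show ?case unfolding sum.lessThan_Suc Suc by (simp only:) (simp add: algebra_simps)
  qed (simp add: alt_def)
  have "Q 0 - alt (int (2 * m)) * Q (real (2 * m)) = - 12 * M"
    by (simp add: alt_def Q_def num_def M_def algebra_simps power2_eq_square)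
  with tele[of "2 * m"] have "(\<Sum>k<2 * m. alt (int k) * (2 * num (real k))) = - 12 * M" by simp
  moreover have "- alt (int k) * parabola m (real k) = alt (int k) * (2 * num (real k)) * (- 1 / (24 * M))" for k
  proof -
    have "parabola m (real k) = num (real k) / (12 * M)" by (simp only: parabola_def num_def M_def)
    then show ?thesis by simp
  qed
  ultimately have "(\<Sum>k<2 * m. - alt (int k) * parabola m (real k)) = 1 / 2"
    using m by (simp only: sum_distrib_right[symmetric]) (simp add: M_def)
  moreover have "(\<Sum>k<2 * m. lap_symbol m (int k)) = (\<Sum>k<2 * m. - alt (int k) * parabola m (real k))"
    by (rule sum.cong) (auto simp: lap_symbol_def)
  ultimately show ?thesis by (simp only: sum_period_lessThan[OF periodic_lap_symbol])
qed

text \<open>The alternating signs cancel, and the constant \<open>2 m\<^sup>2 + 1\<close> in the parabola is what makes its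
mean over a period vanish; the squares are summed with \<open>R t - R (t - 1) = 6 t\<^sup>2\<close>.\<close>

lemma sum_lap_symbol_alt:
  assumes m: "m > 0"
  shows "(\<Sum>k = 1..2 * m. lap_symbol m (int k) * alt (int k)) = 0"
proof -
  define M where "M = real m"
  define R where "R t = t * (t + 1) * (2 * t + 1)" for t :: real
  have tele: "(\<Sum>k<K. 6 * (M - real k)\<^sup>2) = R M - R (M - real K)" for K
  proof (induction K)
    case (Suc K)
    have "6 * t\<^sup>2 = R t - R (t - 1)" for t
      by (simp add: R_def power2_eq_square algebra_simps)
    from this[of "M - real K"] have "6 * (M - real K)\<^sup>2 = R (M - real K) - R (M - real (Suc K))"
      by (simp add: diff_diff_eq add.commute)
    with Suc show ?case by simp
  qed simp
  have "(\<Sum>k<2 * m. parabola m (real k))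
      = (\<Sum>k<2 * m. (2 * M\<^sup>2 + 1) - 6 * (M - real k)\<^sup>2) / (12 * M)"
    by (simp add: parabola_def M_def sum_divide_distrib)
  also have "(\<Sum>k<2 * m. (2 * M\<^sup>2 + 1) - 6 * (M - real k)\<^sup>2) = 2 * M * (2 * M\<^sup>2 + 1) - (R M - R (M - 2 * M))"
    unfolding sum_subtractf tele by (simp add: M_def)
  also have "\<dots> = 0"
    by (simp add: R_def power2_eq_square algebra_simps)
  finally have "(\<Sum>k<2 * m. parabola m (real k)) = 0" by simp
  moreover have "(\<Sum>k<2 * m. lap_symbol m (int k) * alt (int k)) = - (\<Sum>k<2 * m. parabola m (real k))"
    unfolding sum_negf[symmetric] by (rule sum.cong) (auto simp: lap_symbol_def alt_def)
  moreover have per: "periodic (2 * m) (\<lambda>k. lap_symbol m k * alt k)"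
    by (intro periodic_mult periodic_lap_symbol periodic_alt) simp
  ultimately show ?thesis unfolding sum_period_lessThan[OF per] by simp
qed

section \<open>The wheel\<close>

definition wheel_lap :: "nat \<Rightarrow> nat \<Rightarrow> nat \<Rightarrow> real" where
  "wheel_lap m i j = (if i = 0 then (if j = 0 then real m else - 1 / 2)
     else if j = 0 then - 1 / 2 else lap_symbol m (int j - int i))"

definition wheel_dst :: "nat \<Rightarrow> nat \<Rightarrow> nat \<Rightarrow> real" where
  "wheel_dst m i j = (if i = 0 then (if j = 0 then 0 else 1)
     else if j = 0 then 1 else 2 - signless (2 * m) (int j - int i))"

text \<open>The vector \<open>s\<close>: zero at the centre and alternating around the rim, which closes up because the rim
has even length.\<close>

definition wheel_alt :: "nat \<Rightarrow> real" where
  "wheel_alt i = (if i = 0 then 0 else alt (int i))"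

lemma sum_hub_rim: "(\<Sum>k<2 * m + 1. f k) = f 0 + (\<Sum>k = 1..2 * m. f k)" for f :: "nat \<Rightarrow> real"
proof -
  have "{..<2 * m + 1} = insert 0 {1..2 * m}" by auto
  then show ?thesis by simp
qed

lemma rim_cong: "(\<And>k. k \<noteq> 0 \<Longrightarrow> f k = g k) \<Longrightarrow> (\<Sum>k = 1..N. f k) = (\<Sum>k = 1..N. g k)" for f :: "nat \<Rightarrow> real"
  by (rule sum.cong) auto

lemma lap_symbol_minus: "lap_symbol m (- k) = lap_symbol m k"
proof (cases "k mod int (2 * m) = 0")
  case True
  then have "(- k) mod int (2 * m) = 0" by (simp add: mod_eq_0_iff_dvd)
  then show ?thesis unfolding lap_symbol_def True by (simp add: alt_def)
next
  case False
  then have "(- k) mod int (2 * m) = int (2 * m) - k mod int (2 * m)" by (simp add: zmod_zminus1_eq_if)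
  moreover have "real_of_int (int (2 * m) - r) = 2 * real m - real_of_int r" for r by simp
  ultimately show ?thesis unfolding lap_symbol_def by (simp only: parabola_reflect) (simp add: alt_def)
qed

lemma signless_minus: "signless N (- k) = signless N k"
  using dirac_minus[of N 0 k] dirac_minus[of N "- k" 1] dirac_minus[of N 1 k]
  by (simp add: signless_def add.commute)

lemma wheel_lap_sym: "wheel_lap m i j = wheel_lap m j i"
  using lap_symbol_minus[of m "int j - int i"] by (simp add: wheel_lap_def)

lemma wheel_dst_sym: "wheel_dst m i j = wheel_dst m j i"
  using signless_minus[of "2 * m" "int j - int i"] by (simp add: wheel_dst_def)

lemma periodic_one: "periodic N (\<lambda>_. 1)" by (simp add: periodic_def)

lemma sum_signless: "N > 0 \<Longrightarrow> (\<Sum>k = 1..N. signless N (c - int k)) = 4"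
  using sum_mult_signless[OF periodic_one] by simp

lemma sum_lap_symbol_shift: "m > 0 \<Longrightarrow> (\<Sum>k = 1..2 * m. lap_symbol m (int k - c)) = 1 / 2"
  using sum_period_shift[OF periodic_lap_symbol, of m "- c"] sum_lap_symbol[of m] by simp

lemma sum_lap_symbol_alt_shift:
  assumes "m > 0"
  shows "(\<Sum>k = 1..2 * m. lap_symbol m (int k - c) * alt (int k)) = 0"
proof -
  have per: "periodic (2 * m) (\<lambda>k. lap_symbol m k * alt k)"
    by (intro periodic_mult periodic_lap_symbol periodic_alt) simp
  have "alt (int k) = alt c * alt (int k + - c)" for k
    by (simp add: alt_def)
  then have "(\<Sum>k = 1..2 * m. lap_symbol m (int k - c) * alt (int k))
      = alt c * (\<Sum>k = 1..2 * m. lap_symbol m (int k + - c) * alt (int k + - c))"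
    unfolding sum_distrib_left by (intro sum.cong) auto
  also have "\<dots> = 0"
    unfolding sum_period_shift[OF per] sum_lap_symbol_alt[OF assms] by simp
  finally show ?thesis .
qed

text \<open>With \<open>M\<close> the rim block of the Laplacian, \<open>J\<close> the all-ones matrix and the rim block of \<open>D\<close> written
as \<open>2 J - (2 I + A)\<close>, the rim block of \<open>L D\<close> is \<open>- J / 2 + 2 M J - M (2 I + A)\<close>. As \<open>M\<close> has row sums
\<open>1 / 2\<close>, the recurrence for the symbol turns this into \<open>J / 2 - 2 I + s s' / m\<close>. The entries in the
row or the column of the centre only need row sums.\<close>

lemma wheel_laplacian_distance_pair:
  assumes m: "m > 0"
  shows "laplacian_distance_pair (2 * m + 1) (wheel_lap m) (wheel_dst m) wheel_alt
    (\<lambda>i. if i = 0 then 2 - real m else 1 / 2) (1 / real m)"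
proof
  note simps = wheel_lap_def wheel_dst_def wheel_alt_def
  have N: "2 * m > 0" using m by simp
  have peralt: "periodic (2 * m) alt" by (rule periodic_alt) simp
  have rim_alt: "(\<Sum>k = Suc 0..2 * m. alt (int k)) = 0" using sum_alt[of "2 * m"] by simp
  show "(\<Sum>k<2 * m + 1. wheel_lap m i k) = 0" for i
    unfolding sum_hub_rim
  proof (cases "i = 0")
    case True
    then show "wheel_lap m i 0 + (\<Sum>k = 1..2 * m. wheel_lap m i k) = 0"
      by (simp add: simps cong: rim_cong)
  next
    case False
    then have "(\<Sum>k = 1..2 * m. wheel_lap m i k) = (\<Sum>k = 1..2 * m. lap_symbol m (int k - int i))"
      by (intro rim_cong) (simp add: simps)
    then show "wheel_lap m i 0 + (\<Sum>k = 1..2 * m. wheel_lap m i k) = 0"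
      using False unfolding sum_lap_symbol_shift[OF m] by (simp add: simps)
  qed
  show "(\<Sum>k<2 * m + 1. wheel_lap m i k * wheel_alt k) = 0" for i
    unfolding sum_hub_rim
  proof (cases "i = 0")
    case True
    then have "(\<Sum>k = 1..2 * m. wheel_lap m i k * wheel_alt k) = (\<Sum>k = 1..2 * m. - 1 / 2 * alt (int k))"
      by (intro rim_cong) (simp add: simps)
    then show "wheel_lap m i 0 * wheel_alt 0 + (\<Sum>k = 1..2 * m. wheel_lap m i k * wheel_alt k) = 0"
      unfolding sum_distrib_left[symmetric] by (simp add: wheel_alt_def rim_alt)
  next
    case False
    then have "(\<Sum>k = 1..2 * m. wheel_lap m i k * wheel_alt k) = (\<Sum>k = 1..2 * m. lap_symbol m (int k - int i) * alt (int k))"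
      by (intro rim_cong) (simp add: simps)
    then show "wheel_lap m i 0 * wheel_alt 0 + (\<Sum>k = 1..2 * m. wheel_lap m i k * wheel_alt k) = 0"
      unfolding sum_lap_symbol_alt_shift[OF m] by (simp add: wheel_alt_def)
  qed
  show "(\<Sum>k<2 * m + 1. wheel_dst m i k * wheel_alt k) = 0" for i
    unfolding sum_hub_rim
  proof (cases "i = 0")
    case True
    then have "(\<Sum>k = 1..2 * m. wheel_dst m i k * wheel_alt k) = (\<Sum>k = 1..2 * m. alt (int k))"
      by (intro rim_cong) (simp add: simps)
    then show "wheel_dst m i 0 * wheel_alt 0 + (\<Sum>k = 1..2 * m. wheel_dst m i k * wheel_alt k) = 0"
      by (simp add: wheel_alt_def rim_alt)
  next
    case False
    then have "(\<Sum>k = 1..2 * m. wheel_dst m i k * wheel_alt k)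
        = (\<Sum>k = 1..2 * m. 2 * alt (int k) - alt (int k) * signless (2 * m) (int i - int k))"
      using signless_minus[of "2 * m" "int i - int k" for k]
      by (intro rim_cong) (simp add: simps algebra_simps)
    also have "\<dots> = 2 * (\<Sum>k = 1..2 * m. alt (int k)) - (\<Sum>k = 1..2 * m. alt (int k) * signless (2 * m) (int i - int k))"
      unfolding sum_subtractf sum_distrib_left ..
    also have "\<dots> = 0"
      unfolding sum_mult_signless[OF peralt N] by (simp add: rim_alt)
    finally show "wheel_dst m i 0 * wheel_alt 0 + (\<Sum>k = 1..2 * m. wheel_dst m i k * wheel_alt k) = 0"
      by (simp add: wheel_alt_def)
  qed
  show "(\<Sum>k<2 * m + 1. wheel_alt k) = 0"
  proof -
    have "(\<Sum>k = 1..2 * m. wheel_alt k) = (\<Sum>k = 1..2 * m. alt (int k))"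
      by (intro rim_cong) (simp add: simps)
    then show ?thesis unfolding sum_hub_rim by (simp add: wheel_alt_def rim_alt)
  qed
  fix i j assume i: "i < 2 * m + 1" and j: "j < 2 * m + 1"
  have sum_const: "(\<Sum>k = 1..2 * m. c) = 2 * real m * c" for c by simp
  have rim0: "(\<Sum>k = 1..2 * m. wheel_lap m 0 k * wheel_dst m k j)
     = (if j = 0 then - real m else 2 - 2 * real m)"
  proof (cases "j = 0")
    case True
    then have "(\<Sum>k = 1..2 * m. wheel_lap m 0 k * wheel_dst m k j) = (\<Sum>k = 1..2 * m. - 1 / 2)"
      by (intro rim_cong) (simp add: simps)
    then show ?thesis using True unfolding sum_const by simp
  next
    case False
    then have "(\<Sum>k = 1..2 * m. wheel_lap m 0 k * wheel_dst m k j)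
        = (\<Sum>k = 1..2 * m. - 1 + 1 / 2 * signless (2 * m) (int j - int k))"
      by (intro rim_cong) (simp add: simps field_simps)
    also have "\<dots> = 2 - 2 * real m"
      unfolding sum.distrib sum_distrib_left[symmetric] sum_signless[OF N] sum_const by simp
    finally show ?thesis using False by simp
  qed
  have rim: "(\<Sum>k = 1..2 * m. wheel_lap m i k * wheel_dst m k j)
     = (if j = 0 then 1 / 2 else 1 - 2 * dirac (2 * m) (int j - int i) + alt (int j - int i) / real m)" if i0: "i \<noteq> 0"
  proof (cases "j = 0")
    case True
    then have "(\<Sum>k = 1..2 * m. wheel_lap m i k * wheel_dst m k j) = (\<Sum>k = 1..2 * m. lap_symbol m (int k - int i))"
      using i0 by (intro rim_cong) (simp add: simps)
    then show ?thesis using True unfolding sum_lap_symbol_shift[OF m] by simp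
  next
    case False
    have per: "periodic (2 * m) (\<lambda>k. lap_symbol m (k - int i))"
      using periodic_shift[OF periodic_lap_symbol, of m "- int i"] by simp
    have "(\<Sum>k = 1..2 * m. wheel_lap m i k * wheel_dst m k j)
        = (\<Sum>k = 1..2 * m. 2 * lap_symbol m (int k - int i) - lap_symbol m (int k - int i) * signless (2 * m) (int j - int k))"
      using False i0 by (intro rim_cong) (simp add: simps algebra_simps)
    also have "\<dots> = 2 * (1 / 2) - (2 * lap_symbol m (int j - int i) + lap_symbol m (int j + 1 - int i) + lap_symbol m (int j - 1 - int i))"
      unfolding sum_subtractf sum_distrib_left[symmetric] sum_lap_symbol_shift[OF m] sum_mult_signless[OF per N] ..
    also have "2 * lap_symbol m (int j - int i) + lap_symbol m (int j + 1 - int i) + lap_symbol m (int j - 1 - int i)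
        = 2 * dirac (2 * m) (int j - int i) - alt (int j - int i) / real m"
      using lap_symbol_recurrence[OF m, of "int j - int i"] by (simp add: algebra_simps)
    finally show ?thesis using False by simp
  qed
  have dirac: "dirac (2 * m) (int j - int i) = (if i = j then 1 else 0)" if "i \<noteq> 0" "j \<noteq> 0"
  proof -
    have "int (2 * m) dvd int j - int i \<longleftrightarrow> i = j"
    proof
      assume "int (2 * m) dvd int j - int i"
      moreover have "\<bar>int j - int i\<bar> < int (2 * m)" using i j that by linarith
      ultimately show "i = j" using zdvd_not_zless[of "\<bar>int j - int i\<bar>" "int (2 * m)"] by (cases "i = j") auto
    qed simp
    then show ?thesis by (simp add: dirac_def)
  qed
  show "(\<Sum>k<2 * m + 1. wheel_lap m i k * wheel_dst m k j)
      = (if i = j then -2 else 0) + (if i = 0 then 2 - real m else 1 / 2) + 1 / real m * wheel_alt i * wheel_alt j"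
  proof (cases "i = 0")
    case True
    then show ?thesis unfolding sum_hub_rim by (simp only: rim0) (simp add: simps)
  next
    case False
    then show ?thesis unfolding sum_hub_rim rim[OF False] using dirac
      by (cases "j = 0") (auto simp: simps alt_diff mult.commute)
  qed
qed (use wheel_lap_sym wheel_dst_sym in simp_all)

text \<open>On vectors with zero sum the all-ones parts of \<open>D\<close> cancel against the entries of the centre, and
what remains is minus the form of \<open>2 I + A\<close> on the rim.\<close>

lemma wheel_dst_nonpos:
  assumes m: "m > 0" and z: "(\<Sum>i<2 * m + 1. z i) = 0"
  shows "(\<Sum>i<2 * m + 1. \<Sum>j<2 * m + 1. z i * wheel_dst m i j * z j) \<le> 0"
proof -
  \<comment> \<open>In terms of \<open>S\<close> and \<open>B\<close>, the form is \<open>2 z\<^sub>0 S + 2 S\<^sup>2 - B\<close>, and \<open>z\<^sub>0 = - S\<close>.\<close>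
  define S where "S = (\<Sum>i = 1..2 * m. z i)"
  define B where "B = (\<Sum>i = 1..2 * m. \<Sum>j = 1..2 * m. z i * signless (2 * m) (int i - int j) * z j)"
  have z0: "z 0 = - S" using z unfolding sum_hub_rim S_def by simp
  have "(\<Sum>j<2 * m + 1. z 0 * wheel_dst m 0 j * z j) = z 0 * S"
  proof -
    have "(\<Sum>j = 1..2 * m. z 0 * wheel_dst m 0 j * z j) = (\<Sum>j = 1..2 * m. z 0 * z j)"
      by (intro rim_cong) (simp add: wheel_dst_def)
    then show ?thesis unfolding sum_hub_rim S_def by (simp add: wheel_dst_def sum_distrib_left)
  qed
  moreover have "(\<Sum>j<2 * m + 1. z i * wheel_dst m i j * z j)
     = z i * z 0 + 2 * z i * S - (\<Sum>j = 1..2 * m. z i * signless (2 * m) (int i - int j) * z j)" if "i \<noteq> 0" for i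
  proof -
    have "(\<Sum>j = 1..2 * m. z i * wheel_dst m i j * z j)
        = (\<Sum>j = 1..2 * m. 2 * z i * z j - z i * signless (2 * m) (int i - int j) * z j)"
      using that signless_minus[of "2 * m" "int i - int j" for j]
      by (intro rim_cong) (simp add: wheel_dst_def algebra_simps)
    then show ?thesis unfolding sum_hub_rim S_def sum_subtractf sum_distrib_left[symmetric]
      using that by (simp add: wheel_dst_def)
  qed
  then have "(\<Sum>i = 1..2 * m. \<Sum>j<2 * m + 1. z i * wheel_dst m i j * z j)
     = (\<Sum>i = 1..2 * m. z i * (z 0 + 2 * S) - (\<Sum>j = 1..2 * m. z i * signless (2 * m) (int i - int j) * z j))"
    by (intro rim_cong) (simp add: algebra_simps)
  then have "(\<Sum>i = 1..2 * m. \<Sum>j<2 * m + 1. z i * wheel_dst m i j * z j) = S * (z 0 + 2 * S) - B"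
    unfolding sum_subtractf sum_distrib_right[symmetric] B_def S_def .
  ultimately have "(\<Sum>i<2 * m + 1. \<Sum>j<2 * m + 1. z i * wheel_dst m i j * z j) = z 0 * S + (S * (z 0 + 2 * S) - B)"
    by (simp only: sum_hub_rim[of "\<lambda>i. \<Sum>j<2 * m + 1. z i * wheel_dst m i j * z j"])
  also have "\<dots> = - B" by (simp add: z0 algebra_simps)
  also have "\<dots> \<le> 0" using signless_quadratic_form_nonneg[of "2 * m" z] m by (simp add: B_def)
  finally show ?thesis .
qed

section \<open>Identification of the matrices\<close>

text \<open>\<open>g k\<close> is \<open>m + 1\<close> for even \<open>m - k\<close> and \<open>m\<close> otherwise; in both cases it has the parity of \<open>k + 1\<close>.\<close>

lemma wheel_alpha_eq_lap_symbol:
  assumes m: "m > 0" and k: "k \<le> m"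
  shows "wheel_alpha (2 * m + 1) k = lap_symbol m (int k)"
proof -
  have "wheel_g (2 * m + 1) k = int (m + (if even (m - k) then 1 else 0))"
    by (auto simp: wheel_g_def)
  then have "(-1 :: real) powi wheel_g (2 * m + 1) k = (-1) ^ (m + (if even (m - k) then 1 else 0))"
    by (simp only: power_int_of_nat)
  also have "\<dots> = - alt (int k)"
    using k by (cases "even m"; cases "even k") (auto simp: alt_def)
  finally have sign: "(-1 :: real) powi wheel_g (2 * m + 1) k = - alt (int k)" .
  have "int k mod int (2 * m) = int k" using m k by simp
  then show ?thesis
    unfolding wheel_alpha_def lap_symbol_def Let_def sign parabola_def
    by (simp add: algebra_simps)
qed

lemma cyclic_difference:
  assumes "i < N" "j < N"
  shows "int ((j + N - i) mod N) = (int j - int i) mod int N"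
proof -
  have "int (j + N - i) = int j - int i + int N" using assms by simp
  then show ?thesis unfolding zmod_int by simp
qed

text \<open>The two positions \<open>k\<close> and \<open>2 m - k\<close> at which the first row of \<open>C\<^sub>k\<close> is nonzero coincide for
\<open>k = m\<close>, and 0 is never hit; so exactly one \<open>k\<close> contributes to each off-diagonal entry of the rim
block.\<close>

lemma sum_reflected_pair:
  fixes a :: "nat \<Rightarrow> real"
  assumes r: "r < 2 * m"
  shows "(\<Sum>k = 1..m. a k * (if r = k \<or> r = 2 * m - k then 1 else 0)) = (if r = 0 then 0 else a (min r (2 * m - r)))"
proof -
  have "(\<Sum>k = 1..m. a k * (if r = k \<or> r = 2 * m - k then 1 else 0))
      = (\<Sum>k = 1..m. if k = min r (2 * m - r) then a k else 0)"
    using r by (intro sum.cong) auto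
  also have "\<dots> = (if min r (2 * m - r) \<in> {1..m} then a (min r (2 * m - r)) else 0)"
    by (simp only: sum.delta finite_atLeastAtMost)
  also have "min r (2 * m - r) \<in> {1..m} \<longleftrightarrow> r \<noteq> 0" using r by auto
  finally show ?thesis by simp
qed

text \<open>Reduces the sum of circulants to a single one. Above \<open>m\<close> the coefficient of an entry is
\<open>\<alpha>\<close> at the reflected index, and the symbol is invariant under this reflection.\<close>

lemma special_laplacian_eq:
  assumes m: "m > 0"
  shows "special_laplacian (2 * m + 1) = entry_mat (2 * m + 1) (wheel_lap m)" (is "?L = ?R")
proof (rule eq_matI)
  fix i j assume "i < dim_row ?R" "j < dim_col ?R"
  then have ij: "i < 2 * m + 1" "j < 2 * m + 1" by (simp_all add: entry_mat_def)
  show "?L $$ (i, j) = ?R $$ (i, j)"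
  proof (cases "i = 0 \<or> j = 0")
    case True
    then show ?thesis using ij by (auto simp: special_laplacian_def entry_mat_def wheel_lap_def)
  next
    case False
    define i' j' r where "i' = i - 1" and "j' = j - 1" and "r = (j' + 2 * m - i') mod (2 * m)"
    have i': "i' < 2 * m" "j' < 2 * m" "int j' - int i' = int j - int i"
      using ij False by (auto simp: i'_def j'_def)
    have shift: "i = Suc i'" "j = Suc j'" using False by (simp_all add: i'_def j'_def)
    have r: "r < 2 * m" using m by (simp add: r_def)
    have rint: "int r = (int j - int i) mod int (2 * m)"
      unfolding r_def using cyclic_difference[OF i'(1,2)] i'(3) by simp
    have r0: "r = 0 \<longleftrightarrow> i' = j'"
    proof
      assume "r = 0"
      then have "int i' mod int (2 * m) = int j' mod int (2 * m)"
        using rint i'(3) by (metis dvd_eq_mod_eq_0 mod_eq_dvd_iff of_nat_0)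
      then show "i' = j'" using i' by simp
    qed (simp add: r_def)
    have c: "circ (wheel_c (2 * m + 1) k) $$ (i', j') = (if r = k \<or> r = 2 * m - k then 1 else 0)" for k
      using i' r by (simp add: circ_def wheel_c_def r_def[symmetric])
    have "?L $$ (i, j) = (real (2 * m + 1) * (real (2 * m + 1) - 2) / (6 * (real (2 * m + 1) - 1))) * (if i' = j' then 1 else 0)
       + (\<Sum>k = 1..m. wheel_alpha (2 * m + 1) k * circ (wheel_c (2 * m + 1) k) $$ (i', j'))"
      unfolding shift using i' by (simp add: special_laplacian_def)
    also have "(\<Sum>k = 1..m. wheel_alpha (2 * m + 1) k * circ (wheel_c (2 * m + 1) k) $$ (i', j'))
       = (\<Sum>k = 1..m. lap_symbol m (int k) * (if r = k \<or> r = 2 * m - k then 1 else 0))"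
      unfolding c by (intro sum.cong refl) (simp only: wheel_alpha_eq_lap_symbol[OF m] atLeastAtMost_iff)
    also have "\<dots> = (if r = 0 then 0 else lap_symbol m (int (min r (2 * m - r))))"
      by (rule sum_reflected_pair[OF r])
    also have "real (2 * m + 1) * (real (2 * m + 1) - 2) / (6 * (real (2 * m + 1) - 1)) = lap_symbol m 0"
    proof -
      have "2 * (real m)\<^sup>2 + 1 - 6 * (real m - 0)\<^sup>2 = - (real (2 * m + 1) * (real (2 * m + 1) - 2))"
        by (simp add: power2_eq_square algebra_simps)
      then have "parabola m 0 = - (real (2 * m + 1) * (real (2 * m + 1) - 2)) / (12 * real m)"
        by (simp only: parabola_def)
      then show ?thesis by (simp add: lap_symbol_def alt_def)
    qed
    also have "lap_symbol m 0 * (if i' = j' then 1 else 0) + (if r = 0 then 0 else lap_symbol m (int (min r (2 * m - r))))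
       = lap_symbol m (int r)"
    proof (cases "r \<le> m")
      case True
      then show ?thesis using r0 by auto
    next
      case False
      have "lap_symbol m (int (2 * m - r)) = lap_symbol m (- int r)"
        by (rule periodicD[OF periodic_lap_symbol]) (use r in \<open>simp add: of_nat_diff\<close>)
      then show ?thesis using False r0 r by (auto simp: lap_symbol_minus min_def)
    qed
    also have "\<dots> = lap_symbol m (int j - int i)"
      by (rule periodicD[OF periodic_lap_symbol]) (simp only: rint mod_mod_trivial)
    finally show ?thesis using False ij by (simp add: entry_mat_def wheel_lap_def)
  qed
qed (use m in \<open>auto simp: special_laplacian_def entry_mat_def\<close>)

lemma periodic_signless: "periodic N (signless N)"
proof -
  have "periodic N (dirac N)" by (simp add: periodic_def dirac_def dvd_eq_mod_eq_0)
  from this periodic_shift[OF this, of "-1"] periodic_shift[OF this, of 1]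
  show ?thesis unfolding periodic_def signless_def by (metis (no_types, lifting) uminus_add_conv_diff add.commute)
qed

text \<open>For \<open>N > 2\<close> the two neighbours 1 and \<open>N - 1\<close> of 0 in the cycle are distinct and different from 0.\<close>

lemma signless_residue:
  assumes r: "r < N" and N: "N > 2"
  shows "signless N (int r) = (if r = 0 then 2 else if r = 1 \<or> r = N - 1 then 1 else 0)"
proof -
  have "int N dvd int r \<longleftrightarrow> r = 0" using r by (auto dest: dvd_imp_le simp: int_dvd_int_iff)
  moreover have "int N dvd int r - 1 \<longleftrightarrow> r = 1"
  proof (cases r)
    case 0
    then show ?thesis using N by simp
  next
    case (Suc q)
    have "N dvd q \<longleftrightarrow> q = 0" using r Suc by (auto dest: dvd_imp_le)
    then show ?thesis using Suc by (simp add: int_dvd_int_iff)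
  qed
  moreover have "int N dvd int r + 1 \<longleftrightarrow> r = N - 1"
  proof -
    have "int N dvd int r + 1 \<longleftrightarrow> N dvd Suc r" by (metis int_dvd_int_iff of_nat_Suc add.commute)
    also have "\<dots> \<longleftrightarrow> r = N - 1" using r by (auto dest: dvd_imp_le)
    finally show ?thesis .
  qed
  ultimately show ?thesis using r N by (auto simp: signless_def dirac_def)
qed

lemma wheel_dist_mat_eq:
  assumes m: "m \<ge> 2"
  shows "wheel_dist_mat (2 * m + 1) = entry_mat (2 * m + 1) (wheel_dst m)" (is "?L = ?R")
proof (rule eq_matI)
  have block: "?L = four_block_mat (0\<^sub>m 1 1) (mat 1 (2 * m) (\<lambda>_. 1)) (mat (2 * m) 1 (\<lambda>_. 1)) (circ (wheel_u (2 * m + 1)))"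
    using wheel_dist_mat_block[of "2 * m + 1"] m by simp
  fix i j assume "i < dim_row ?R" "j < dim_col ?R"
  then have ij: "i < 2 * m + 1" "j < 2 * m + 1" by (simp_all add: entry_mat_def)
  show "?L $$ (i, j) = ?R $$ (i, j)"
  proof (cases "i = 0 \<or> j = 0")
    case True
    then show ?thesis using ij unfolding block by (auto simp: entry_mat_def wheel_dst_def circ_def wheel_u_def)
  next
    case False
    define i' j' r where "i' = i - 1" and "j' = j - 1" and "r = (j' + 2 * m - i') mod (2 * m)"
    have i': "i' < 2 * m" "j' < 2 * m" "int j' - int i' = int j - int i"
      using ij False by (auto simp: i'_def j'_def)
    have shift: "i = Suc i'" "j = Suc j'" using False by (simp_all add: i'_def j'_def)
    have r: "r < 2 * m" using m by (simp add: r_def)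
    have rint: "int r = (int j - int i) mod int (2 * m)"
      unfolding r_def using cyclic_difference[OF i'(1,2)] i'(3) by simp
    have "?L $$ (i, j) = wheel_u (2 * m + 1) $ r"
      unfolding block shift using i' r by (simp add: circ_def wheel_u_def r_def[symmetric])
    also have "\<dots> = 2 - signless (2 * m) (int r)"
      using signless_residue[OF r] m r by (simp add: wheel_u_def)
    also have "signless (2 * m) (int r) = signless (2 * m) (int j - int i)"
      by (rule periodicD[OF periodic_signless]) (simp only: rint mod_mod_trivial)
    finally show ?thesis using False ij by (simp add: entry_mat_def wheel_dst_def)
  qed
qed (auto simp: wheel_dist_mat_def entry_mat_def)

section \<open>Properties of the special Laplacian\<close>

theorem theorem2:
  fixes n :: nat
  assumes "n \<ge> 5" and "odd n"
  shows "special_laplacian n *\<^sub>v vec n (\<lambda>_. 1) = 0\<^sub>v n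
    \<and> vec_space.rank n (special_laplacian n) = n - 2
    \<and> (\<forall>i < n. \<forall>j < n. wheel_dist_mat n $$ (i, j)
          = moore_penrose (special_laplacian n) $$ (i, i)
            + moore_penrose (special_laplacian n) $$ (j, j)
            - 2 * moore_penrose (special_laplacian n) $$ (i, j))
    \<and> psd_mat (special_laplacian n)"
proof -
  obtain m where n: "n = 2 * m + 1" using \<open>odd n\<close> by (elim oddE)
  with \<open>n \<ge> 5\<close> have m: "m \<ge> 2" "m > 0" by auto
  interpret laplacian_distance_pair n "wheel_lap m" "wheel_dst m" wheel_alt
    "\<lambda>i. if i = 0 then 2 - real m else 1 / 2" "1 / real m"
    unfolding n by (rule wheel_laplacian_distance_pair[OF m(2)])
  have L: "special_laplacian n = entry_mat n (wheel_lap m)"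
    unfolding n by (rule special_laplacian_eq[OF m(2)])
  have D: "wheel_dist_mat n = entry_mat n (wheel_dst m)"
    unfolding n by (rule wheel_dist_mat_eq[OF m(1)])
  have MP: "moore_penrose (special_laplacian n) = entry_mat n theta"
    unfolding L by (rule moore_penrose_eqI[OF is_moore_penrose_theta])
  have "special_laplacian n *\<^sub>v vec n (\<lambda>_. 1) = 0\<^sub>v n"
    unfolding L entry_mat_mult_vec by (intro eq_vecI) (simp_all add: l_ones)
  moreover have "vec_space.rank n (special_laplacian n) = n - 2"
    unfolding L by (rule rank_laplacian) (use n m in \<open>simp_all add: wheel_alt_def alt_def\<close>)
  moreover have "wheel_dist_mat n $$ (i, j)
      = moore_penrose (special_laplacian n) $$ (i, i) + moore_penrose (special_laplacian n) $$ (j, j)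
        - 2 * moore_penrose (special_laplacian n) $$ (i, j)" if "i < n" "j < n" for i j
  proof -
    have diag: "wheel_dst m i i = 0" for i
      using signless_residue[of 0 "2 * m"] m by (simp add: wheel_dst_def)
    show ?thesis unfolding MP D using that theta_distance[OF diag diag, of i j] by (simp add: entry_mat_def)
  qed
  moreover have "psd_mat (special_laplacian n)"
    unfolding L using psd_laplacian wheel_dst_nonpos[OF m(2)] by (simp only: n)
  ultimately show ?thesis by blast
qed

end
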